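(* Let $S$ be a right LCM semigroup with identity. Then $\sum_{s\in F_a}\bar e_{sS}=1$ holds in the boundary quotient $\mathcal{Q}(S)$ for every accurate foundation set $F_a$ for $S$. If $S$ has property (AR), then $\mathcal{Q}(S)$ is the quotient of $C^*(S)$ by the relation $$\sum_{s\in F} e_{sS}=1\quad\text{for every accurate foundation set } F \text{ for } S. \qquad (\mathrm{Q}_a)$$ In other words, if $S$ has property (AR), then $\mathcal{Q}(S)$ is the universal $C^*$-algebra generated by a representation of $S$ by isometries $(\bar v_s)_{s\in S}$ and projections $(\bar e_X)_{X\in\mathcal{J}(S)}$ subject to the relations, for all $s,t\in S$ and $X,Y\in\mathcal{J}(S)$: (L1) $\bar v_s\bar v_t=\bar v_{st}$; (L2) $\bar v_s\bar e_X\bar v_s^*=\bar e_{sX}$; (L3) $\bar e_S=1$, $\bar e_\emptyset=0$; (L4) $\bar e_X\bar e_Y=\bar e_{X\cap Y}$; together with $\sum_{s\in F}\bar e_{sS}=1$ for every accurate foundation set $F$ for $S$.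
   Context: All semigroups are countable, discrete and left cancellative. A semigroup is right LCM if the intersection of two principal right ideals is either empty or again a principal right ideal. For a right LCM semigroup $S$ with identity, the family of constructible right ideals is $\mathcal{J}(S)=\{sS\mid s\in S\}\cup\{\emptyset\}$. The full semigroup $C^*$-algebra $C^*(S)$ is the universal $C^*$-algebra generated by isometries $(v_s)_{s\in S}$ and projections $(e_X)_{X\in\mathcal{J}(S)}$ satisfying $v_sv_t=v_{st}$, $v_se_Xv_s^*=e_{sX}$, $e_S=1$, $e_\emptyset=0$, $e_Xe_Y=e_{X\cap Y}$ for all $s,t\in S$, $X,Y\in\mathcal{J}(S)$. A finite subset $F\subset S$ is a foundation set for $S$ if for every $s\in S$ there is $t\in F$ with $sS\cap tS\neq\emptyset$. A foundation set $F$ is accurate if $sS\cap tS=\emptyset$ for all distinct $s,t\in F$. $S$ has the accurate refinement property, property (AR), if for every foundation set $F$ there is an accurate foundation set $F_a$ such that every $f_a\in F_a$ lies in $fS$ for some $f\in F$. The boundary quotient $\mathcal{Q}(S)$ is the quotient of $C^*(S)$ by the relations $\prod_{s\in F}(1-e_{sS})=0$ for every foundation set $F$ for $S$. The images of $v_s$ and $e_{X}$ in $\mathcal{Q}(S)$ are denoted $\bar v_s$ and $\bar e_{X}$. *)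

theory Defs
  imports "HOL-Analysis.Analysis" "HOL-Library.Poly_Mapping" "HOL-Library.Countable"
begin

section \<open>C*-algebras\<close>

class scaleC =
  fixes scaleC :: "complex \<Rightarrow> 'a \<Rightarrow> 'a"  (infixr \<open>*\<^sub>C\<close> 75)

class involution =
  fixes star :: "'a \<Rightarrow> 'a"  (\<open>_\<^sup>\<star>\<close> [1000] 999)

text \<open>Unital complex C*-algebras. The multiplicative unit comes from \<^class>\<open>monoid_mult\<close> rather than
  from \<^class>\<open>real_normed_algebra_1\<close>, so that the zero algebra is not excluded.\<close>

class cstar_algebra = real_normed_algebra + banach + monoid_mult + scaleC + involution +
  assumes scaleC_add_right: "c *\<^sub>C (x + y) = c *\<^sub>C x + c *\<^sub>C y"
    and scaleC_add_left: "(c + d) *\<^sub>C x = c *\<^sub>C x + d *\<^sub>C x"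
    and scaleC_scaleC: "c *\<^sub>C (d *\<^sub>C x) = (c * d) *\<^sub>C x"
    and scaleR_scaleC: "r *\<^sub>R x = of_real r *\<^sub>C x"
    and scaleC_mult_left: "(c *\<^sub>C x) * y = c *\<^sub>C (x * y)"
    and scaleC_mult_right: "x * (c *\<^sub>C y) = c *\<^sub>C (x * y)"
    and norm_scaleC: "norm (c *\<^sub>C x) = cmod c * norm x"
    and star_star: "(x\<^sup>\<star>)\<^sup>\<star> = x"
    and star_add: "(x + y)\<^sup>\<star> = x\<^sup>\<star> + y\<^sup>\<star>"
    and star_scaleC: "(c *\<^sub>C x)\<^sup>\<star> = cnj c *\<^sub>C x\<^sup>\<star>"
    and star_mult: "(x * y)\<^sup>\<star> = y\<^sup>\<star> * x\<^sup>\<star>"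
    and cstar_identity: "norm (x\<^sup>\<star> * x) = (norm x)\<^sup>2"

definition star_hom :: "('a::cstar_algebra \<Rightarrow> 'b::cstar_algebra) \<Rightarrow> bool" where
  "star_hom f \<longleftrightarrow>
     (\<forall>x y. f (x + y) = f x + f y) \<and> (\<forall>c x. f (c *\<^sub>C x) = c *\<^sub>C f x) \<and>
     (\<forall>x y. f (x * y) = f x * f y) \<and> (\<forall>x. f (x\<^sup>\<star>) = (f x)\<^sup>\<star>)"

definition isometry :: "'a::cstar_algebra \<Rightarrow> bool" where
  "isometry v \<longleftrightarrow> v\<^sup>\<star> * v = 1"

definition projection :: "'a::cstar_algebra \<Rightarrow> bool" where
  "projection e \<longleftrightarrow> e\<^sup>\<star> = e \<and> e * e = e"

definition cstar_subalgebra :: "'a::cstar_algebra set \<Rightarrow> bool" where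
  "cstar_subalgebra B \<longleftrightarrow> closed B \<and> 0 \<in> B \<and> (\<forall>x\<in>B. \<forall>y\<in>B. x + y \<in> B \<and> x * y \<in> B) \<and>
     (\<forall>c. \<forall>x\<in>B. c *\<^sub>C x \<in> B) \<and> (\<forall>x\<in>B. x\<^sup>\<star> \<in> B)"

definition generates_cstar :: "'a::cstar_algebra set \<Rightarrow> bool" where
  "generates_cstar G \<longleftrightarrow> (\<forall>B. cstar_subalgebra B \<and> G \<subseteq> B \<longrightarrow> B = UNIV)"

definition closed_ideal :: "'a::cstar_algebra set \<Rightarrow> bool" where
  "closed_ideal I \<longleftrightarrow> closed I \<and> 0 \<in> I \<and> (\<forall>x\<in>I. \<forall>y\<in>I. x + y \<in> I) \<and>
     (\<forall>c. \<forall>x\<in>I. c *\<^sub>C x \<in> I) \<and> (\<forall>a. \<forall>x\<in>I. a * x \<in> I \<and> x * a \<in> I)"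

definition closed_ideal_generated :: "'a::cstar_algebra set \<Rightarrow> 'a set" where
  "closed_ideal_generated R = \<Inter>{I. closed_ideal I \<and> R \<subseteq> I}"

text \<open>\<open>is_quotient_by q R\<close>: the map \<open>q\<close> exhibits its codomain as the quotient C*-algebra of its
  domain by the relations \<open>r = 0\<close> for \<open>r \<in> R\<close>, i.e. by the closed two-sided ideal generated by
  \<open>R\<close>, with the quotient norm.\<close>

definition is_quotient_by :: "('a::cstar_algebra \<Rightarrow> 'b::cstar_algebra) \<Rightarrow> 'a set \<Rightarrow> bool" where
  "is_quotient_by q R \<longleftrightarrow> star_hom q \<and> surj q \<and>
     {x. q x = 0} = closed_ideal_generated R \<and>
     (\<forall>x. norm (q x) = infdist x (closed_ideal_generated R))"


section \<open>Right LCM semigroups with identity\<close>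

definition right_ideal :: "'a::monoid_mult \<Rightarrow> 'a set" where
  "right_ideal s = {s * t | t. True}"

class right_lcm_monoid = monoid_mult + countable +
  assumes left_cancel: "a * b = a * c \<Longrightarrow> b = c"
    and right_lcm: "{a * t | t. True} \<inter> {b * t | t. True} = {} \<or>
          (\<exists>c. {a * t | t. True} \<inter> {b * t | t. True} = {c * t | t. True})"

definition constructible_ideals :: "'a::right_lcm_monoid set set" where
  "constructible_ideals = {right_ideal s | s. True} \<union> {{}}"

definition translate :: "'a::right_lcm_monoid \<Rightarrow> 'a set \<Rightarrow> 'a set" where
  "translate s X = {s * x | x. x \<in> X}"

definition foundation_set :: "'a::right_lcm_monoid set \<Rightarrow> bool" where
  "foundation_set F \<longleftrightarrow> finite F \<and> (\<forall>s. \<exists>t\<in>F. right_ideal s \<inter> right_ideal t \<noteq> {})"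

definition accurate_foundation_set :: "'a::right_lcm_monoid set \<Rightarrow> bool" where
  "accurate_foundation_set F \<longleftrightarrow> foundation_set F \<and>
     (\<forall>s\<in>F. \<forall>t\<in>F. s \<noteq> t \<longrightarrow> right_ideal s \<inter> right_ideal t = {})"

definition accurate_refinement_property :: "'a::right_lcm_monoid itself \<Rightarrow> bool" where
  "accurate_refinement_property _ \<longleftrightarrow>
     (\<forall>F::'a set. foundation_set F \<longrightarrow>
        (\<exists>F\<^sub>a. accurate_foundation_set F\<^sub>a \<and> (\<forall>f\<^sub>a\<in>F\<^sub>a. \<exists>f\<in>F. f\<^sub>a \<in> right_ideal f)))"

definition semigroup_relations ::
  "('a::right_lcm_monoid \<Rightarrow> 'b::cstar_algebra) \<Rightarrow> ('a set \<Rightarrow> 'b) \<Rightarrow> bool" where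
  "semigroup_relations v e \<longleftrightarrow>
     (\<forall>s. isometry (v s)) \<and>
     (\<forall>X\<in>constructible_ideals. projection (e X)) \<and>
     (\<forall>s t. v s * v t = v (s * t)) \<and>
     (\<forall>s. \<forall>X\<in>constructible_ideals. v s * e X * (v s)\<^sup>\<star> = e (translate s X)) \<and>
     e UNIV = 1 \<and> e {} = 0 \<and>
     (\<forall>X\<in>constructible_ideals. \<forall>Y\<in>constructible_ideals. e X * e Y = e (X \<inter> Y))"


section \<open>The free unital *-algebra\<close>

text \<open>Words in symbols \<open>g\<close> and \<open>g\<^sup>*\<close>, with concatenation written additively so that the
  convolution product of \<^type>\<open>poly_mapping\<close> is the product of the free algebra.\<close>

datatype 'g letter = Pos 'g | Adj 'g

datatype 'g star_word = Word "'g letter list"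

instantiation star_word :: (type) monoid_add
begin
definition "0 = Word []"
fun plus_star_word where "Word u + Word w = Word (u @ w)"
instance
proof
  fix a b c :: "'a star_word"
  show "a + b + c = a + (b + c)" by (cases a; cases b; cases c) simp
  show "0 + a = a" by (cases a) (simp add: zero_star_word_def)
  show "a + 0 = a" by (cases a) (simp add: zero_star_word_def)
qed
end

type_synonym 'g free_star_algebra = "'g star_word \<Rightarrow>\<^sub>0 complex"

fun letter_star :: "'g letter \<Rightarrow> 'g letter" where
  "letter_star (Pos g) = Adj g"
| "letter_star (Adj g) = Pos g"

fun word_star :: "'g star_word \<Rightarrow> 'g star_word" where
  "word_star (Word w) = Word (rev (map letter_star w))"

lemma letter_star_letter_star [simp]: "letter_star (letter_star x) = x"
  by (cases x) auto

lemma word_star_word_star [simp]: "word_star (word_star w) = w"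
  by (cases w) (simp add: rev_map o_def)

lemma word_star_add: "word_star (u + w) = word_star w + word_star u"
  by (cases u; cases w) simp

lemma word_star_zero: "word_star 0 = 0"
  by (simp add: zero_star_word_def)

lemma word_star_eq_iff: "word_star u = w \<longleftrightarrow> u = word_star w"
  by auto

lift_definition free_star :: "'g free_star_algebra \<Rightarrow> 'g free_star_algebra"
  is "\<lambda>f w. cnj (f (word_star w))"
proof -
  fix f :: "'g star_word \<Rightarrow> complex"
  assume "finite {k. f k \<noteq> 0}"
  then have "finite (word_star ` {k. f k \<noteq> 0})" by simp
  then show "finite {w. cnj (f (word_star w)) \<noteq> 0}"
    by (rule finite_subset[rotated]) (auto simp: image_iff intro!: exI[of _ "word_star _"])
qed

definition free_scale :: "complex \<Rightarrow> 'g free_star_algebra \<Rightarrow> 'g free_star_algebra" where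
  "free_scale c x = Poly_Mapping.map ((*) c) x"

definition free_gen :: "'g \<Rightarrow> 'g free_star_algebra" where
  "free_gen g = Poly_Mapping.single (Word [Pos g]) 1"

lemma free_induct:
  fixes x :: "'g free_star_algebra"
  assumes "P 0" and "\<And>w c x. P x \<Longrightarrow> P (Poly_Mapping.single w c + x)"
  shows "P x"
proof -
  have "P (\<Sum>w\<in>A. Poly_Mapping.single w (Poly_Mapping.lookup x w))" if "finite A" for A
    using that by (induction A rule: finite_induct) (auto intro: assms)
  moreover have "x = (\<Sum>w\<in>Poly_Mapping.keys x. Poly_Mapping.single w (Poly_Mapping.lookup x w))"
    by (rule poly_mapping_eqI)
       (simp add: lookup_sum lookup_single when_def in_keys_iff)
  ultimately show ?thesis
    by (metis finite_keys)
qed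

lemma free_star_add: "free_star (x + y) = free_star x + free_star y"
  by (rule poly_mapping_eqI) (simp add: free_star.rep_eq lookup_add)

lemma free_star_zero [simp]: "free_star 0 = 0"
  by (rule poly_mapping_eqI) (simp add: free_star.rep_eq)

lemma free_star_diff: "free_star (x - y) = free_star x - free_star y"
  by (rule poly_mapping_eqI) (simp add: free_star.rep_eq lookup_minus)

lemma free_star_star [simp]: "free_star (free_star x) = x"
  by (rule poly_mapping_eqI) (simp add: free_star.rep_eq)

lemma free_star_single:
  "free_star (Poly_Mapping.single w c) = Poly_Mapping.single (word_star w) (cnj c)"
  by (rule poly_mapping_eqI) (auto simp: free_star.rep_eq lookup_single when_def word_star_eq_iff)

lemma free_star_single_mult:
  "free_star (Poly_Mapping.single w c * y) = free_star y * free_star (Poly_Mapping.single w c)"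
  by (induction y rule: free_induct)
     (simp_all add: distrib_left distrib_right free_star_add free_star_single mult_single
       word_star_add mult.commute)

lemma free_star_mult: "free_star (x * y) = free_star y * free_star x"
  by (induction x rule: free_induct)
     (simp_all add: distrib_left distrib_right free_star_add free_star_single_mult)

lemma free_scale_conv: "free_scale c x = Poly_Mapping.single 0 c * x"
  by (simp add: free_scale_def mult_map_scale_conv_mult)

lemma single_0_central:
  fixes x :: "'g free_star_algebra"
  shows "x * Poly_Mapping.single 0 c = Poly_Mapping.single 0 c * x"
  by (induction x rule: free_induct) (simp_all add: distrib_left distrib_right mult_single mult.commute)

lemma free_scale_add: "free_scale c (x + y) = free_scale c x + free_scale c y"
  by (simp add: free_scale_conv distrib_left)

lemma free_scale_add_left: "free_scale (c + d) x = free_scale c x + free_scale d x"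
  by (simp add: free_scale_conv distrib_right single_add)

lemma free_scale_mult_left: "free_scale c x * y = free_scale c (x * y)"
  by (simp add: free_scale_conv mult.assoc)

lemma free_scale_mult_right: "x * free_scale c y = free_scale c (x * y)"
  unfolding free_scale_conv by (metis mult.assoc single_0_central)

lemma free_star_scale: "free_star (free_scale c x) = free_scale (cnj c) (free_star x)"
  by (simp add: free_scale_conv free_star_mult free_star_single word_star_zero single_0_central)

lemma free_scale_free_scale: "free_scale c (free_scale d x) = free_scale (c * d) x"
  by (simp add: free_scale_conv mult_single flip: mult.assoc)

lemma free_star_one: "free_star 1 = 1"
  by (metis free_star_mult free_star_star mult_1 mult.right_neutral)


section \<open>C*-seminorms and the universal seminorm\<close>

definition cstar_seminorm :: "('g free_star_algebra \<Rightarrow> real) \<Rightarrow> bool" where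
  "cstar_seminorm p \<longleftrightarrow>
     (\<forall>x. 0 \<le> p x) \<and> (\<forall>x y. p (x + y) \<le> p x + p y) \<and> (\<forall>c x. p (free_scale c x) = cmod c * p x) \<and>
     (\<forall>x y. p (x * y) \<le> p x * p y) \<and> (\<forall>x. p (free_star x * x) = (p x)\<^sup>2)"

definition relator_seminorms :: "'g free_star_algebra set \<Rightarrow> ('g free_star_algebra \<Rightarrow> real) set" where
  "relator_seminorms R = {p. cstar_seminorm p \<and> (\<forall>r\<in>R. p r = 0)}"

text \<open>The universal C*-algebra on a set of generators subject to relators \<open>R\<close> is the Hausdorff
  completion of the free *-algebra in the largest C*-seminorm that vanishes on \<open>R\<close>. The
  supremum is meaningful when the C*-seminorms vanishing on \<open>R\<close> are pointwise bounded, which is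
  shown below for the relators used here.\<close>

definition universal_seminorm :: "'g free_star_algebra set \<Rightarrow> 'g free_star_algebra \<Rightarrow> real" where
  "universal_seminorm R x = (SUP p\<in>relator_seminorms R. p x)"

lemma cstar_seminormD:
  assumes "cstar_seminorm p"
  shows "0 \<le> p x" "p (x + y) \<le> p x + p y" "p (free_scale c x) = cmod c * p x"
    "p (x * y) \<le> p x * p y" "p (free_star x * x) = (p x)\<^sup>2"
  using assms unfolding cstar_seminorm_def by blast+

lemma cstar_seminorm_zero: "cstar_seminorm p \<Longrightarrow> p 0 = 0"
  using cstar_seminormD(3)[of p 0 0] by (simp add: free_scale_conv)

lemma cstar_seminorm_uminus: "cstar_seminorm p \<Longrightarrow> p (- x) = p x"
  using cstar_seminormD(3)[of p "-1" x] by (simp add: free_scale_conv single_uminus)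

lemma cstar_seminorm_minus_commute: "cstar_seminorm p \<Longrightarrow> p (x - y) = p (y - x)"
  using cstar_seminorm_uminus[of p "x - y"] by simp

lemma cstar_seminorm_triangle: "cstar_seminorm p \<Longrightarrow> p x \<le> p y + p (x - y)"
  using cstar_seminormD(2)[of p y "x - y"] by simp

lemma cstar_seminorm_one: "cstar_seminorm p \<Longrightarrow> p 1 \<le> 1"
proof -
  assume "cstar_seminorm p"
  then have "p 1 = (p 1)\<^sup>2"
    using cstar_seminormD(5)[of p 1] by (simp add: free_star_one)
  then show ?thesis by (auto simp: power2_eq_square)
qed

lemma cstar_seminorm_star: "cstar_seminorm p \<Longrightarrow> p (free_star x) = p x"
proof -
  assume p: "cstar_seminorm p"
  have le: "p y \<le> p (free_star y)" for y
  proof (cases "p y = 0")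
    case True then show ?thesis using cstar_seminormD(1)[OF p] by simp
  next
    case False
    then have pos: "0 < p y" using cstar_seminormD(1)[OF p, of y] by simp
    have "p y * p y \<le> p (free_star y) * p y"
      using cstar_seminormD(4,5)[OF p] by (metis power2_eq_square)
    then show ?thesis using pos by simp
  qed
  show ?thesis using le[of x] le[of "free_star x"] by simp
qed


section \<open>The full semigroup C*-algebra\<close>

datatype 'a generator = Isom 'a | Proj "'a set"

definition free_v :: "'a::right_lcm_monoid \<Rightarrow> 'a generator free_star_algebra" where
  "free_v s = free_gen (Isom s)"

definition free_e :: "'a::right_lcm_monoid set \<Rightarrow> 'a generator free_star_algebra" where
  "free_e X = free_gen (Proj X)"

text \<open>Symbols \<open>Proj X\<close> are available for all sets \<open>X\<close>; those with \<open>X\<close> not constructible are set to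
  zero by the last family of relators, so that only the generators \<open>e\<^sub>X\<close> with \<open>X\<close> constructible
  remain.\<close>

definition semigroup_relators :: "'a::right_lcm_monoid generator free_star_algebra set" where
  "semigroup_relators =
     {free_star (free_v s) * free_v s - 1 | s. True} \<union>
     {free_star (free_e X) - free_e X | X. X \<in> constructible_ideals} \<union>
     {free_e X * free_e X - free_e X | X. X \<in> constructible_ideals} \<union>
     {free_v s * free_v t - free_v (s * t) | s t. True} \<union>
     {free_v s * free_e X * free_star (free_v s) - free_e (translate s X) | s X.
        X \<in> constructible_ideals} \<union>
     {free_e UNIV - 1, free_e {}} \<union>
     {free_e X * free_e Y - free_e (X \<inter> Y) | X Y.
        X \<in> constructible_ideals \<and> Y \<in> constructible_ideals} \<union>
     {free_e X | X. X \<notin> constructible_ideals}"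

definition semigroup_seminorm :: "'a::right_lcm_monoid generator free_star_algebra \<Rightarrow> real" where
  "semigroup_seminorm = universal_seminorm semigroup_relators"

context
  fixes p :: "'a::right_lcm_monoid generator free_star_algebra \<Rightarrow> real"
  assumes p: "p \<in> relator_seminorms semigroup_relators"
begin

lemma relator_seminorm: "cstar_seminorm p"
  and relator_zero: "r \<in> semigroup_relators \<Longrightarrow> p r = 0"
  using p by (auto simp: relator_seminorms_def)

lemma relator_eq: "x - y \<in> semigroup_relators \<Longrightarrow> p x = p y"
  using cstar_seminorm_triangle[OF relator_seminorm, of x y]
    cstar_seminorm_triangle[OF relator_seminorm, of y x]
    relator_zero[of "x - y"] cstar_seminorm_minus_commute[OF relator_seminorm, of x y] by simp

lemma relator_gen_le: "p (free_gen g) \<le> 1"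
proof (cases g)
  case (Isom s)
  have "free_star (free_v s) * free_v s - 1 \<in> semigroup_relators"
    unfolding semigroup_relators_def by blast
  then have "(p (free_v s))\<^sup>2 \<le> 1"
    using relator_eq cstar_seminormD(5)[OF relator_seminorm] cstar_seminorm_one[OF relator_seminorm]
    by metis
  then show ?thesis using Isom
    by (metis abs_le_square_iff abs_of_nonneg cstar_seminormD(1) free_v_def one_power2
        relator_seminorm zero_le_one)
next
  case (Proj X)
  show ?thesis
  proof (cases "X \<in> constructible_ideals")
    case False
    then have "free_e X \<in> semigroup_relators"
      unfolding semigroup_relators_def by blast
    then show ?thesis using relator_zero Proj by (simp add: free_e_def)
  next
    case True
    let ?e = "free_e X"
    have r: "free_star ?e - ?e \<in> semigroup_relators" "?e * ?e - ?e \<in> semigroup_relators"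
      using True unfolding semigroup_relators_def by blast+
    have "p (free_star ?e * ?e) \<le> p ((free_star ?e - ?e) * ?e) + p (?e * ?e)"
      using cstar_seminormD(2)[OF relator_seminorm, of "(free_star ?e - ?e) * ?e" "?e * ?e"]
      by (simp add: left_diff_distrib)
    also have "p ((free_star ?e - ?e) * ?e) \<le> 0"
      using cstar_seminormD(4)[OF relator_seminorm, of "free_star ?e - ?e" ?e] relator_zero[OF r(1)]
      by simp
    also have "p (?e * ?e) = p ?e" by (rule relator_eq[OF r(2)])
    finally have "p ?e * p ?e \<le> 1 * p ?e"
      using cstar_seminormD(5)[OF relator_seminorm, of ?e] by (simp add: power2_eq_square)
    then have "p ?e \<le> 1"
      using cstar_seminormD(1)[OF relator_seminorm, of ?e] mult_right_le_imp_le[of "p ?e" "p ?e" 1]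
      by (cases "p ?e = 0") auto
    then show ?thesis using Proj by (simp add: free_e_def)
  qed
qed

lemma relator_letter_le: "p (Poly_Mapping.single (Word [l]) 1) \<le> 1"
proof (cases l)
  case (Pos g) then show ?thesis using relator_gen_le[of g] by (simp add: free_gen_def)
next
  case (Adj g)
  then have "Poly_Mapping.single (Word [l]) 1 = free_star (free_gen g)"
    by (simp add: free_gen_def free_star_single)
  then show ?thesis
    using relator_gen_le[of g] cstar_seminorm_star[OF relator_seminorm] by metis
qed

lemma relator_word_le: "p (Poly_Mapping.single (Word w) 1) \<le> 1"
proof (induction w)
  case Nil
  then show ?case using cstar_seminorm_one[OF relator_seminorm]
    by (simp flip: zero_star_word_def)
next
  case (Cons l w)
  have "Poly_Mapping.single (Word (l # w)) (1::complex) =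
      Poly_Mapping.single (Word [l]) 1 * Poly_Mapping.single (Word w) 1"
    by (simp add: mult_single)
  then have "p (Poly_Mapping.single (Word (l # w)) 1) \<le>
      p (Poly_Mapping.single (Word [l]) 1) * p (Poly_Mapping.single (Word w) 1)"
    using cstar_seminormD(4)[OF relator_seminorm] by metis
  also have "\<dots> \<le> 1 * 1"
    by (intro mult_mono relator_letter_le Cons cstar_seminormD(1)[OF relator_seminorm]) auto
  finally show ?case by simp
qed

lemma relator_single_le: "p (Poly_Mapping.single w c) \<le> cmod c"
proof -
  obtain u where w: "w = Word u" by (cases w)
  have "Poly_Mapping.single w c = free_scale c (Poly_Mapping.single w 1)"
    by (simp add: free_scale_conv mult_single)
  then have "p (Poly_Mapping.single w c) = cmod c * p (Poly_Mapping.single w 1)"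
    using cstar_seminormD(3)[OF relator_seminorm] by metis
  also have "\<dots> \<le> cmod c * 1" unfolding w by (intro mult_left_mono relator_word_le) simp
  finally show ?thesis by simp
qed

end

lemma relator_seminorms_bounded:
  fixes x :: "'a::right_lcm_monoid generator free_star_algebra"
  shows "\<exists>B. \<forall>p\<in>relator_seminorms semigroup_relators. p x \<le> B"
proof (induction x rule: free_induct)
  case 1
  then show ?case
    by (auto simp: relator_seminorms_def cstar_seminorm_zero intro!: exI[of _ 0])
next
  case (2 w c x)
  then obtain B where B: "\<forall>p\<in>relator_seminorms semigroup_relators. p x \<le> B" by blast
  have "p (Poly_Mapping.single w c + x) \<le> cmod c + B"
    if p: "p \<in> relator_seminorms semigroup_relators" for p
    using cstar_seminormD(2)[OF relator_seminorm[OF p], of "Poly_Mapping.single w c" x]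
      relator_single_le[OF p, of w c] bspec[OF B p] by linarith
  then show ?case by blast
qed

lemma relator_seminorms_bdd:
  "bdd_above ((\<lambda>p. p x) ` relator_seminorms semigroup_relators)"
  using relator_seminorms_bounded[of x] unfolding bdd_above_def by blast

lemma relator_seminorms_zero: "(\<lambda>x. 0) \<in> relator_seminorms R"
  by (simp add: relator_seminorms_def cstar_seminorm_def)

lemma semigroup_seminorm_upper:
  "p \<in> relator_seminorms semigroup_relators \<Longrightarrow> p x \<le> semigroup_seminorm x"
  unfolding semigroup_seminorm_def universal_seminorm_def
  by (rule cSUP_upper[OF _ relator_seminorms_bdd])

lemma semigroup_seminorm_least:
  "(\<And>p. p \<in> relator_seminorms semigroup_relators \<Longrightarrow> p x \<le> B) \<Longrightarrow> semigroup_seminorm x \<le> B"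
  unfolding semigroup_seminorm_def universal_seminorm_def
  using relator_seminorms_zero by (intro cSUP_least) auto

lemma semigroup_seminorm_nonneg: "0 \<le> semigroup_seminorm x"
  using semigroup_seminorm_upper[OF relator_seminorms_zero, of x] by simp

lemma semigroup_seminorm_cstar: "cstar_seminorm semigroup_seminorm"
  unfolding cstar_seminorm_def
proof (intro conjI allI)
  note D = cstar_seminormD[OF relator_seminorm]
  note U = semigroup_seminorm_upper and N = semigroup_seminorm_nonneg
  fix x y :: "'a generator free_star_algebra" and c :: complex
  show "0 \<le> semigroup_seminorm x" by (rule N)
  show "semigroup_seminorm (x + y) \<le> semigroup_seminorm x + semigroup_seminorm y"
  proof (rule semigroup_seminorm_least)
    fix p :: "'a generator free_star_algebra \<Rightarrow> real"
    assume p: "p \<in> relator_seminorms semigroup_relators"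
    show "p (x + y) \<le> semigroup_seminorm x + semigroup_seminorm y"
      using D(2)[OF p, of x y] U[OF p, of x] U[OF p, of y] by linarith
  qed
  show "semigroup_seminorm (x * y) \<le> semigroup_seminorm x * semigroup_seminorm y"
  proof (rule semigroup_seminorm_least)
    fix p :: "'a generator free_star_algebra \<Rightarrow> real"
    assume p: "p \<in> relator_seminorms semigroup_relators"
    show "p (x * y) \<le> semigroup_seminorm x * semigroup_seminorm y"
      using D(4)[OF p, of x y] mult_mono[OF U[OF p, of x] U[OF p, of y] N D(1)[OF p]] by linarith
  qed
  have le: "semigroup_seminorm (free_scale c x) \<le> cmod c * semigroup_seminorm x"
    for c and x :: "'a generator free_star_algebra"
    by (rule semigroup_seminorm_least) (simp add: D(3) U mult_left_mono)
  show "semigroup_seminorm (free_scale c x) = cmod c * semigroup_seminorm x"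
  proof (cases "c = 0")
    case True
    then show ?thesis using le[of 0 x] N[of "free_scale 0 x"] by simp
  next
    case False
    have "semigroup_seminorm x = semigroup_seminorm (free_scale (inverse c) (free_scale c x))"
      using False by (simp add: free_scale_free_scale) (simp add: free_scale_conv)
    also have "\<dots> \<le> cmod (inverse c) * semigroup_seminorm (free_scale c x)" by (rule le)
    finally have "cmod c * semigroup_seminorm x \<le>
        cmod c * (cmod (inverse c) * semigroup_seminorm (free_scale c x))"
      by (intro mult_left_mono) auto
    also have "\<dots> = semigroup_seminorm (free_scale c x)"
      using False by (metis mult.assoc mult_1 norm_mult norm_one right_inverse)
    finally show ?thesis using le[of c x] by simp
  qed
  show "semigroup_seminorm (free_star x * x) = (semigroup_seminorm x)\<^sup>2"
  proof (rule antisym)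
    show "semigroup_seminorm (free_star x * x) \<le> (semigroup_seminorm x)\<^sup>2"
      by (rule semigroup_seminorm_least) (simp add: D(1,5) U power_mono)
    have "semigroup_seminorm x \<le> sqrt (semigroup_seminorm (free_star x * x))"
    proof (rule semigroup_seminorm_least)
      fix p :: "'a generator free_star_algebra \<Rightarrow> real"
      assume p: "p \<in> relator_seminorms semigroup_relators"
      show "p x \<le> sqrt (semigroup_seminorm (free_star x * x))"
        using D(5)[OF p, of x] U[OF p, of "free_star x * x"] by (intro real_le_rsqrt) simp
    qed
    then show "(semigroup_seminorm x)\<^sup>2 \<le> semigroup_seminorm (free_star x * x)"
      using N[of x] N[of "free_star x * x"] power_mono[of _ _ 2] real_sqrt_pow2 by metis
  qed
qed

text \<open>The completion is realised as Cauchy sequences in the free *-algebra modulo null sequences,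
  both with respect to \<^const>\<open>semigroup_seminorm\<close>.\<close>

definition cauchy_seq :: "(nat \<Rightarrow> 'a::right_lcm_monoid generator free_star_algebra) \<Rightarrow> bool" where
  "cauchy_seq X \<longleftrightarrow>
     (\<forall>\<epsilon>>0. \<exists>M. \<forall>m\<ge>M. \<forall>n\<ge>M. semigroup_seminorm (X m - X n) < \<epsilon>)"

definition cauchy_rel :: "(nat \<Rightarrow> 'a::right_lcm_monoid generator free_star_algebra) \<Rightarrow>
    (nat \<Rightarrow> 'a generator free_star_algebra) \<Rightarrow> bool" where
  "cauchy_rel X Y \<longleftrightarrow> cauchy_seq X \<and> cauchy_seq Y \<and>
     (\<lambda>n. semigroup_seminorm (X n - Y n)) \<longlonglongrightarrow> 0"

lemmas sn = cstar_seminormD[OF semigroup_seminorm_cstar]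
lemmas sn_zero = cstar_seminorm_zero[OF semigroup_seminorm_cstar]
lemmas sn_uminus = cstar_seminorm_uminus[OF semigroup_seminorm_cstar]
lemmas sn_minus_commute = cstar_seminorm_minus_commute[OF semigroup_seminorm_cstar]
lemmas sn_triangle = cstar_seminorm_triangle[OF semigroup_seminorm_cstar]
lemmas sn_star = cstar_seminorm_star[OF semigroup_seminorm_cstar]

lemma sn_diff_triangle:
  "semigroup_seminorm (x - z) \<le> semigroup_seminorm (x - y) + semigroup_seminorm (y - z)"
  using sn(2)[of "x - y" "y - z"] by simp

lemma sn_abs_diff: "\<bar>semigroup_seminorm x - semigroup_seminorm y\<bar> \<le> semigroup_seminorm (x - y)"
  using sn_triangle[of x y] sn_triangle[of y x] sn_minus_commute[of x y] by linarith

lemma cauchy_seqI: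
  assumes "cauchy_seq X" "cauchy_seq Y" "0 \<le> B"
    and "\<And>m n. semigroup_seminorm (Z m - Z n) \<le>
      B * (semigroup_seminorm (X m - X n) + semigroup_seminorm (Y m - Y n))"
  shows "cauchy_seq Z"
  unfolding cauchy_seq_def
proof (intro allI impI)
  fix \<epsilon> :: real assume "\<epsilon> > 0"
  define \<delta> where "\<delta> = \<epsilon> / (2 * (B + 1))"
  have \<delta>: "\<delta> > 0" using \<open>\<epsilon> > 0\<close> assms(3) by (simp add: \<delta>_def)
  obtain M N where M: "\<And>m n. m \<ge> M \<Longrightarrow> n \<ge> M \<Longrightarrow> semigroup_seminorm (X m - X n) < \<delta>"
    and N: "\<And>m n. m \<ge> N \<Longrightarrow> n \<ge> N \<Longrightarrow> semigroup_seminorm (Y m - Y n) < \<delta>"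
    using assms(1,2) \<delta> unfolding cauchy_seq_def by meson
  have "semigroup_seminorm (Z m - Z n) < \<epsilon>" if "m \<ge> max M N" "n \<ge> max M N" for m n
  proof -
    have "semigroup_seminorm (Z m - Z n) \<le> B * (\<delta> + \<delta>)"
      using M[of m n] N[of m n] that assms(3)
      by (intro order_trans[OF assms(4)] mult_left_mono) auto
    also have "\<dots> < (B + 1) * (\<delta> + \<delta>)" using \<delta> by (intro mult_strict_right_mono) auto
    also have "\<dots> = (2 * (B + 1)) * \<delta>" by (simp add: algebra_simps)
    also have "\<dots> = \<epsilon>" using assms(3) by (simp only: \<delta>_def times_divide_eq_right) (rule nonzero_mult_div_cancel_left, simp)
    finally show ?thesis .
  qed
  then show "\<exists>M. \<forall>m\<ge>M. \<forall>n\<ge>M. semigroup_seminorm (Z m - Z n) < \<epsilon>" by blast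
qed

lemma cauchy_seq_norm: "cauchy_seq X \<Longrightarrow> Cauchy (\<lambda>n. semigroup_seminorm (X n))"
  unfolding cauchy_seq_def Cauchy_def dist_real_def
  by (meson sn_abs_diff le_less_trans)

lemma cauchy_seq_norm_convergent:
  "cauchy_seq X \<Longrightarrow> convergent (\<lambda>n. semigroup_seminorm (X n))"
  using cauchy_seq_norm real_Cauchy_convergent by blast

lemma cauchy_seq_bounded:
  assumes "cauchy_seq X"
  shows "\<exists>B\<ge>0. \<forall>n. semigroup_seminorm (X n) \<le> B"
proof -
  obtain B where "\<forall>n. norm (semigroup_seminorm (X n)) \<le> B"
    using Cauchy_Bseq[OF cauchy_seq_norm[OF assms]] unfolding Bseq_def by blast
  then show ?thesis
    using sn(1)[of "X 0"] by (intro exI[of _ B]) (simp, meson abs_ge_self order_trans)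
qed

lemma cauchy_seq_const [intro, simp]: "cauchy_seq (\<lambda>n. x)"
  by (simp add: cauchy_seq_def sn_zero)

lemma cauchy_seq_add [intro]:
  assumes "cauchy_seq X" "cauchy_seq Y"
  shows "cauchy_seq (\<lambda>n. X n + Y n)"
proof (rule cauchy_seqI[OF assms, of 1])
  fix m n
  show "semigroup_seminorm (X m + Y m - (X n + Y n)) \<le>
      1 * (semigroup_seminorm (X m - X n) + semigroup_seminorm (Y m - Y n))"
    using sn(2)[of "X m - X n" "Y m - Y n"] by (simp add: algebra_simps)
qed simp

lemma cauchy_seq_uminus [intro]: "cauchy_seq X \<Longrightarrow> cauchy_seq (\<lambda>n. - X n)"
  unfolding cauchy_seq_def by (metis minus_diff_minus sn_uminus)

lemma cauchy_seq_diff [intro]: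
  "cauchy_seq X \<Longrightarrow> cauchy_seq Y \<Longrightarrow> cauchy_seq (\<lambda>n. X n - Y n)"
  using cauchy_seq_add[of X "\<lambda>n. - Y n"] cauchy_seq_uminus[of Y] by simp

lemma sn_mult_diff:
  "semigroup_seminorm (x * y - x' * y') \<le>
     semigroup_seminorm (x - x') * semigroup_seminorm y + semigroup_seminorm x' * semigroup_seminorm (y - y')"
proof -
  have "x * y - x' * y' = (x - x') * y + x' * (y - y')" by (simp add: algebra_simps)
  then have "semigroup_seminorm (x * y - x' * y') \<le>
      semigroup_seminorm ((x - x') * y) + semigroup_seminorm (x' * (y - y'))"
    using sn(2) by metis
  then show ?thesis using sn(4)[of "x - x'" y] sn(4)[of x' "y - y'"] by linarith
qed

lemma cauchy_seq_mult [intro]: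
  assumes X: "cauchy_seq X" and Y: "cauchy_seq Y"
  shows "cauchy_seq (\<lambda>n. X n * Y n)"
proof -
  obtain B C where B: "B \<ge> 0" "\<And>n. semigroup_seminorm (X n) \<le> B"
    and C: "C \<ge> 0" "\<And>n. semigroup_seminorm (Y n) \<le> C"
    using cauchy_seq_bounded[OF X] cauchy_seq_bounded[OF Y] by blast
  show ?thesis
  proof (rule cauchy_seqI[OF X Y, of "B + C"])
    fix m n
    have "semigroup_seminorm (X m * Y m - X n * Y n) \<le>
        semigroup_seminorm (X m - X n) * C + B * semigroup_seminorm (Y m - Y n)"
      by (intro order_trans[OF sn_mult_diff] add_mono mult_mono B C sn(1)) auto
    also have "\<dots> \<le> (B + C) * (semigroup_seminorm (X m - X n) + semigroup_seminorm (Y m - Y n))"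
      using B(1) C(1) sn(1)[of "X m - X n"] sn(1)[of "Y m - Y n"] by (simp add: algebra_simps)
    finally show "semigroup_seminorm (X m * Y m - X n * Y n) \<le>
        (B + C) * (semigroup_seminorm (X m - X n) + semigroup_seminorm (Y m - Y n))" .
  qed (use B C in auto)
qed

lemma free_scale_diff: "free_scale c (x - y) = free_scale c x - free_scale c y"
  by (simp add: free_scale_conv right_diff_distrib)

lemma cauchy_seq_scale [intro]:
  assumes "cauchy_seq X"
  shows "cauchy_seq (\<lambda>n. free_scale c (X n))"
proof (rule cauchy_seqI[OF assms cauchy_seq_const[of 0], of "cmod c"])
  fix m n
  show "semigroup_seminorm (free_scale c (X m) - free_scale c (X n)) \<le>
      cmod c * (semigroup_seminorm (X m - X n) + semigroup_seminorm (0 - 0))"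
    by (simp add: sn(3) sn_zero flip: free_scale_diff)
qed simp

lemma cauchy_seq_star [intro]: "cauchy_seq X \<Longrightarrow> cauchy_seq (\<lambda>n. free_star (X n))"
  unfolding cauchy_seq_def by (simp add: sn_star flip: free_star_diff)

lemma cauchy_rel_refl: "cauchy_seq X \<Longrightarrow> cauchy_rel X X"
  by (simp add: cauchy_rel_def sn_zero)

lemma cauchy_rel_eq: "cauchy_seq X \<Longrightarrow> (\<And>n. X n = Y n) \<Longrightarrow> cauchy_rel X Y"
  using cauchy_rel_refl[of X] ext[of X Y] by metis

lemma cauchy_rel_sym: "cauchy_rel X Y \<Longrightarrow> cauchy_rel Y X"
  unfolding cauchy_rel_def by (simp add: sn_minus_commute[of "Y _" "X _"])

lemma null_le:
  assumes "\<And>n. semigroup_seminorm (Z n) \<le> f n" and "f \<longlonglongrightarrow> 0"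
  shows "(\<lambda>n. semigroup_seminorm (Z n)) \<longlonglongrightarrow> 0"
  by (rule tendsto_sandwich[OF _ _ tendsto_const assms(2)]) (simp_all add: assms(1) sn(1))

lemma cauchy_rel_trans:
  assumes "cauchy_rel X Y" "cauchy_rel Y Z"
  shows "cauchy_rel X Z"
proof -
  have "(\<lambda>n. semigroup_seminorm (X n - Y n) + semigroup_seminorm (Y n - Z n)) \<longlonglongrightarrow> 0 + 0"
    using assms unfolding cauchy_rel_def by (intro tendsto_add) auto
  then have "(\<lambda>n. semigroup_seminorm (X n - Z n)) \<longlonglongrightarrow> 0"
    by (intro null_le[OF sn_diff_triangle]) simp
  then show ?thesis using assms by (simp add: cauchy_rel_def)
qed

lemma cauchy_rel_part_equivp: "part_equivp cauchy_rel"
  by (rule part_equivpI)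
     (auto intro!: sympI transpI exI[of _ "\<lambda>n. 0"] intro: cauchy_rel_refl cauchy_rel_sym cauchy_rel_trans)

quotient_type (overloaded) 'a semigroup_cstar =
  "nat \<Rightarrow> 'a::right_lcm_monoid generator free_star_algebra" / partial: cauchy_rel
  by (rule cauchy_rel_part_equivp)

lemma cauchy_rel_same [simp]: "cauchy_rel X X \<longleftrightarrow> cauchy_seq X"
  by (auto simp: cauchy_rel_def sn_zero)

instantiation semigroup_cstar :: (right_lcm_monoid) ab_group_add
begin

lift_definition zero_semigroup_cstar :: "'a semigroup_cstar" is "\<lambda>n. 0"
  by simp

lift_definition plus_semigroup_cstar ::
  "'a semigroup_cstar \<Rightarrow> 'a semigroup_cstar \<Rightarrow> 'a semigroup_cstar" is "\<lambda>X Y n. X n + Y n"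
proof -
  fix X X' Y Y' :: "nat \<Rightarrow> 'a generator free_star_algebra"
  assume X: "cauchy_rel X X'" and Y: "cauchy_rel Y Y'"
  have "(\<lambda>n. semigroup_seminorm (X n - X' n) + semigroup_seminorm (Y n - Y' n)) \<longlonglongrightarrow> 0 + 0"
    using X Y unfolding cauchy_rel_def by (intro tendsto_add) auto
  moreover have "semigroup_seminorm (X n + Y n - (X' n + Y' n)) \<le>
      semigroup_seminorm (X n - X' n) + semigroup_seminorm (Y n - Y' n)" for n
    using sn(2)[of "X n - X' n" "Y n - Y' n"] by (simp add: algebra_simps)
  ultimately have "(\<lambda>n. semigroup_seminorm (X n + Y n - (X' n + Y' n))) \<longlonglongrightarrow> 0"
    by (intro null_le) auto
  then show "cauchy_rel (\<lambda>n. X n + Y n) (\<lambda>n. X' n + Y' n)"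
    using X Y by (auto simp: cauchy_rel_def)
qed

lift_definition uminus_semigroup_cstar :: "'a semigroup_cstar \<Rightarrow> 'a semigroup_cstar" is "\<lambda>X n. - X n"
  by (auto simp: cauchy_rel_def minus_diff_minus sn_uminus simp del: minus_diff_eq diff_minus_eq_add)

lift_definition minus_semigroup_cstar ::
  "'a semigroup_cstar \<Rightarrow> 'a semigroup_cstar \<Rightarrow> 'a semigroup_cstar" is "\<lambda>X Y n. X n - Y n"
proof -
  fix X X' Y Y' :: "nat \<Rightarrow> 'a generator free_star_algebra"
  assume X: "cauchy_rel X X'" and Y: "cauchy_rel Y Y'"
  have "(\<lambda>n. semigroup_seminorm (X n - X' n) + semigroup_seminorm (Y' n - Y n)) \<longlonglongrightarrow> 0 + 0"
    using X cauchy_rel_sym[OF Y] unfolding cauchy_rel_def by (intro tendsto_add) auto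
  moreover have "semigroup_seminorm (X n - Y n - (X' n - Y' n)) \<le>
      semigroup_seminorm (X n - X' n) + semigroup_seminorm (Y' n - Y n)" for n
    using sn(2)[of "X n - X' n" "Y' n - Y n"] by (simp add: algebra_simps)
  ultimately have "(\<lambda>n. semigroup_seminorm (X n - Y n - (X' n - Y' n))) \<longlonglongrightarrow> 0"
    by (intro null_le) auto
  then show "cauchy_rel (\<lambda>n. X n - Y n) (\<lambda>n. X' n - Y' n)"
    using X Y by (auto simp: cauchy_rel_def)
qed

instance
proof
  fix a b c :: "'a semigroup_cstar"
  show "a + b + c = a + (b + c)"
    by transfer (rule cauchy_rel_eq, auto simp: algebra_simps)
  show "a + b = b + a"
    by transfer (rule cauchy_rel_eq, auto simp: algebra_simps)
  show "0 + a = a"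
    by transfer simp
  show "- a + a = 0"
    by transfer simp
  show "a - b = a + - b"
    by transfer (rule cauchy_rel_eq, auto)
qed

end

instantiation semigroup_cstar :: (right_lcm_monoid) "{ring, monoid_mult}"
begin

lift_definition one_semigroup_cstar :: "'a semigroup_cstar" is "\<lambda>n. 1"
  by simp

lift_definition times_semigroup_cstar ::
  "'a semigroup_cstar \<Rightarrow> 'a semigroup_cstar \<Rightarrow> 'a semigroup_cstar" is "\<lambda>X Y n. X n * Y n"
proof -
  fix X X' Y Y' :: "nat \<Rightarrow> 'a generator free_star_algebra"
  assume X: "cauchy_rel X X'" and Y: "cauchy_rel Y Y'"
  then obtain B C where B: "B \<ge> 0" "\<And>n. semigroup_seminorm (X' n) \<le> B"
    and C: "C \<ge> 0" "\<And>n. semigroup_seminorm (Y n) \<le> C"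
    using cauchy_seq_bounded[of X'] cauchy_seq_bounded[of Y] unfolding cauchy_rel_def by blast
  have "(\<lambda>n. semigroup_seminorm (X n - X' n) * C + B * semigroup_seminorm (Y n - Y' n)) \<longlonglongrightarrow> 0 * C + B * 0"
    using X Y unfolding cauchy_rel_def by (intro tendsto_intros) auto
  moreover have "semigroup_seminorm (X n * Y n - X' n * Y' n) \<le>
      semigroup_seminorm (X n - X' n) * C + B * semigroup_seminorm (Y n - Y' n)" for n
    by (intro order_trans[OF sn_mult_diff] add_mono mult_mono B C sn(1)) auto
  ultimately have "(\<lambda>n. semigroup_seminorm (X n * Y n - X' n * Y' n)) \<longlonglongrightarrow> 0"
    by (intro null_le) auto
  then show "cauchy_rel (\<lambda>n. X n * Y n) (\<lambda>n. X' n * Y' n)"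
    using X Y by (auto simp: cauchy_rel_def)
qed

instance
proof
  fix a b c :: "'a semigroup_cstar"
  show "a * b * c = a * (b * c)"
    by transfer (rule cauchy_rel_eq, auto simp: mult.assoc)
  show "(a + b) * c = a * c + b * c"
    by transfer (rule cauchy_rel_eq, auto simp: algebra_simps)
  show "a * (b + c) = a * b + a * c"
    by transfer (rule cauchy_rel_eq, auto simp: algebra_simps)
  show "1 * a = a" by transfer simp
  show "a * 1 = a" by transfer simp
qed

end

instantiation semigroup_cstar :: (right_lcm_monoid) "{scaleC, involution, real_vector}"
begin

lift_definition scaleC_semigroup_cstar :: "complex \<Rightarrow> 'a semigroup_cstar \<Rightarrow> 'a semigroup_cstar"
  is "\<lambda>c X n. free_scale c (X n)"
proof -
  fix c and X Y :: "nat \<Rightarrow> 'a generator free_star_algebra"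
  assume X: "cauchy_rel X Y"
  then have "(\<lambda>n. cmod c * semigroup_seminorm (X n - Y n)) \<longlonglongrightarrow> cmod c * 0"
    unfolding cauchy_rel_def by (intro tendsto_intros) auto
  then show "cauchy_rel (\<lambda>n. free_scale c (X n)) (\<lambda>n. free_scale c (Y n))"
    using X by (auto simp: cauchy_rel_def sn(3) simp flip: free_scale_diff)
qed

lift_definition star_semigroup_cstar :: "'a semigroup_cstar \<Rightarrow> 'a semigroup_cstar"
  is "\<lambda>X n. free_star (X n)"
  by (auto simp: cauchy_rel_def sn_star simp flip: free_star_diff)

definition scaleR_semigroup_cstar :: "real \<Rightarrow> 'a semigroup_cstar \<Rightarrow> 'a semigroup_cstar" where
  "scaleR_semigroup_cstar r x = of_real r *\<^sub>C x"

lemma semigroup_cstar_scaleC: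
  fixes x y :: "'a semigroup_cstar"
  shows "c *\<^sub>C (x + y) = c *\<^sub>C x + c *\<^sub>C y"
    and "(c + d) *\<^sub>C x = c *\<^sub>C x + d *\<^sub>C x"
    and "c *\<^sub>C (d *\<^sub>C x) = (c * d) *\<^sub>C x"
    and "1 *\<^sub>C x = x"
proof -
  show "c *\<^sub>C (x + y) = c *\<^sub>C x + c *\<^sub>C y"
    by transfer (rule cauchy_rel_eq, auto simp: free_scale_add)
  show "(c + d) *\<^sub>C x = c *\<^sub>C x + d *\<^sub>C x"
    by transfer (rule cauchy_rel_eq, auto simp: free_scale_add_left)
  show "c *\<^sub>C (d *\<^sub>C x) = (c * d) *\<^sub>C x"
    by transfer (rule cauchy_rel_eq, auto simp: free_scale_free_scale)
  show "1 *\<^sub>C x = x"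
    by transfer (simp add: free_scale_conv)
qed

instance
  by standard (simp_all add: scaleR_semigroup_cstar_def semigroup_cstar_scaleC)

end

instantiation semigroup_cstar :: (right_lcm_monoid) real_normed_vector
begin

lift_definition norm_semigroup_cstar :: "'a semigroup_cstar \<Rightarrow> real"
  is "\<lambda>X. lim (\<lambda>n. semigroup_seminorm (X n))"
proof -
  fix X Y :: "nat \<Rightarrow> 'a generator free_star_algebra"
  assume X: "cauchy_rel X Y"
  then have "(\<lambda>n. semigroup_seminorm (X n - Y n)) \<longlonglongrightarrow> 0" by (simp add: cauchy_rel_def)
  then have "(\<lambda>n. semigroup_seminorm (X n) - semigroup_seminorm (Y n)) \<longlonglongrightarrow> 0"
    by (rule Lim_null_comparison[rotated]) (simp add: sn_abs_diff)
  moreover have "(\<lambda>n. semigroup_seminorm (Y n)) \<longlonglongrightarrow> lim (\<lambda>n. semigroup_seminorm (Y n))"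
    using X cauchy_seq_norm_convergent[of Y] by (simp add: cauchy_rel_def convergent_LIMSEQ_iff)
  ultimately have "(\<lambda>n. semigroup_seminorm (X n) - semigroup_seminorm (Y n) + semigroup_seminorm (Y n))
      \<longlonglongrightarrow> 0 + lim (\<lambda>n. semigroup_seminorm (Y n))"
    by (rule tendsto_add)
  then show "lim (\<lambda>n. semigroup_seminorm (X n)) = lim (\<lambda>n. semigroup_seminorm (Y n))"
    by (simp add: limI)
qed

definition dist_semigroup_cstar :: "'a semigroup_cstar \<Rightarrow> 'a semigroup_cstar \<Rightarrow> real" where
  "dist_semigroup_cstar x y = norm (x - y)"

definition sgn_semigroup_cstar :: "'a semigroup_cstar \<Rightarrow> 'a semigroup_cstar" where
  "sgn_semigroup_cstar x = x /\<^sub>R norm x"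

definition uniformity_semigroup_cstar :: "('a semigroup_cstar \<times> 'a semigroup_cstar) filter" where
  [code del]: "uniformity_semigroup_cstar = (INF e\<in>{0 <..}. principal {(x, y). dist x y < e})"

definition open_semigroup_cstar :: "'a semigroup_cstar set \<Rightarrow> bool" where
  [code del]: "open_semigroup_cstar U \<longleftrightarrow>
     (\<forall>x\<in>U. eventually (\<lambda>(x', y). x' = x \<longrightarrow> y \<in> U) uniformity)"

lemma cauchy_seq_norm_tendsto:
  "cauchy_seq X \<Longrightarrow> (\<lambda>n. semigroup_seminorm (X n)) \<longlonglongrightarrow> lim (\<lambda>n. semigroup_seminorm (X n))"
  using cauchy_seq_norm_convergent by (simp add: convergent_LIMSEQ_iff)

lemma semigroup_cstar_norm_scaleC: "norm (c *\<^sub>C (x :: 'a semigroup_cstar)) = cmod c * norm x"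
proof transfer
  fix c and X :: "nat \<Rightarrow> 'a generator free_star_algebra"
  assume "cauchy_rel X X"
  then have "(\<lambda>n. cmod c * semigroup_seminorm (X n)) \<longlonglongrightarrow> cmod c * lim (\<lambda>n. semigroup_seminorm (X n))"
    by (intro tendsto_intros cauchy_seq_norm_tendsto) simp
  then show "lim (\<lambda>n. semigroup_seminorm (free_scale c (X n))) = cmod c * lim (\<lambda>n. semigroup_seminorm (X n))"
    by (simp add: sn(3) limI)
qed

instance
proof
  fix x y :: "'a semigroup_cstar" and a :: real
  show "dist x y = norm (x - y)" by (rule dist_semigroup_cstar_def)
  show "sgn x = x /\<^sub>R norm x" by (rule sgn_semigroup_cstar_def)
  show "uniformity = (INF e\<in>{0 <..}. principal {(x, y). dist x y < (e::real)} ::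
      ('a semigroup_cstar \<times> 'a semigroup_cstar) filter)"
    by (rule uniformity_semigroup_cstar_def)
  show "open U \<longleftrightarrow> (\<forall>x\<in>U. eventually (\<lambda>(x', y). x' = x \<longrightarrow> y \<in> U) uniformity)"
    for U :: "'a semigroup_cstar set"
    by (rule open_semigroup_cstar_def)
  show "norm x = 0 \<longleftrightarrow> x = 0"
  proof transfer
    fix X :: "nat \<Rightarrow> 'a generator free_star_algebra"
    assume "cauchy_rel X X"
    then show "lim (\<lambda>n. semigroup_seminorm (X n)) = 0 \<longleftrightarrow> cauchy_rel X (\<lambda>n. 0)"
      using cauchy_seq_norm_tendsto[of X] by (simp add: cauchy_rel_def) (metis limI)
  qed
  show "norm (x + y) \<le> norm x + norm y"
  proof transfer
    fix X Y :: "nat \<Rightarrow> 'a generator free_star_algebra"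
    assume "cauchy_rel X X" "cauchy_rel Y Y"
    then have X: "cauchy_seq X" and Y: "cauchy_seq Y" by simp_all
    show "lim (\<lambda>n. semigroup_seminorm (X n + Y n)) \<le>
        lim (\<lambda>n. semigroup_seminorm (X n)) + lim (\<lambda>n. semigroup_seminorm (Y n))"
      using sn(2) by (intro LIMSEQ_le[OF cauchy_seq_norm_tendsto[OF cauchy_seq_add[OF X Y]]
            tendsto_add[OF cauchy_seq_norm_tendsto[OF X] cauchy_seq_norm_tendsto[OF Y]]]) blast
  qed
  show "norm (a *\<^sub>R x) = \<bar>a\<bar> * norm x"
    unfolding scaleR_semigroup_cstar_def semigroup_cstar_norm_scaleC norm_of_real ..
qed

end

definition semigroup_class ::
  "'a::right_lcm_monoid generator free_star_algebra \<Rightarrow> 'a semigroup_cstar" where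
  "semigroup_class x = abs_semigroup_cstar (\<lambda>n. x)"

lemma norm_semigroup_class: "norm (semigroup_class x) = semigroup_seminorm x"
  by (simp add: semigroup_class_def norm_semigroup_cstar.abs_eq)

lemma semigroup_class_diff: "semigroup_class (x - y) = semigroup_class x - semigroup_class y"
  by (simp add: semigroup_class_def minus_semigroup_cstar.abs_eq)

lemma cauchy_seq_class_tendsto:
  assumes "cauchy_seq X"
  shows "(\<lambda>n. semigroup_class (X n)) \<longlonglongrightarrow> abs_semigroup_cstar X"
proof (rule LIMSEQ_I)
  fix \<epsilon> :: real assume "\<epsilon> > 0"
  then obtain M where M: "\<And>m n. m \<ge> M \<Longrightarrow> n \<ge> M \<Longrightarrow> semigroup_seminorm (X m - X n) < \<epsilon> / 2"
    using assms unfolding cauchy_seq_def by (meson half_gt_zero)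
  have "norm (semigroup_class (X m) - abs_semigroup_cstar X) < \<epsilon>" if "m \<ge> M" for m
  proof -
    have c: "cauchy_seq (\<lambda>n. X m - X n)" using assms by auto
    have "semigroup_class (X m) - abs_semigroup_cstar X = abs_semigroup_cstar (\<lambda>n. X m - X n)"
      using assms
      by (simp add: semigroup_class_def minus_semigroup_cstar.abs_eq)
    then have "norm (semigroup_class (X m) - abs_semigroup_cstar X) = lim (\<lambda>n. semigroup_seminorm (X m - X n))"
      using c by (simp add: norm_semigroup_cstar.abs_eq)
    also have "\<dots> \<le> \<epsilon> / 2"
      using M[OF that] by (intro LIMSEQ_le_const2[OF cauchy_seq_norm_tendsto[OF c]])
        (auto intro!: exI[of _ M] less_imp_le)
    finally show ?thesis using \<open>\<epsilon> > 0\<close> by simp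
  qed
  then show "\<exists>no. \<forall>n\<ge>no. norm (semigroup_class (X n) - abs_semigroup_cstar X) < \<epsilon>" by blast
qed

lemma semigroup_class_dense:
  assumes "\<epsilon> > 0"
  shows "\<exists>y. norm (x - semigroup_class y) < \<epsilon>"
proof -
  obtain X where X: "cauchy_seq X" "x = abs_semigroup_cstar X"
    by (metis Quotient_abs_rep[OF Quotient_semigroup_cstar]
        Quotient_rep_reflp[OF Quotient_semigroup_cstar] cauchy_rel_same)
  then show ?thesis
    using LIMSEQ_D[OF cauchy_seq_class_tendsto[OF X(1)] assms] by (metis norm_minus_commute order_refl)
qed

instance semigroup_cstar :: (right_lcm_monoid) banach
proof
  fix X :: "nat \<Rightarrow> 'a semigroup_cstar"
  assume X: "Cauchy X"
  have "\<forall>n. \<exists>y. norm (X n - semigroup_class y) < inverse (real (Suc n))"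
    using semigroup_class_dense by (metis inverse_positive_iff_positive of_nat_0_less_iff zero_less_Suc)
  then obtain Y where Y: "\<And>n. norm (X n - semigroup_class (Y n)) < inverse (real (Suc n))"
    by metis
  then have null: "(\<lambda>n. X n - semigroup_class (Y n)) \<longlonglongrightarrow> 0"
    by (intro Lim_null_comparison[OF _ LIMSEQ_inverse_real_of_nat] always_eventually allI less_imp_le)
  have "Cauchy (\<lambda>n. semigroup_class (Y n))"
  proof (rule CauchyI)
    fix \<epsilon> :: real assume "0 < \<epsilon>"
    then have \<epsilon>: "\<epsilon> / 3 > 0" by simp
    obtain M where M: "\<And>m n. m \<ge> M \<Longrightarrow> n \<ge> M \<Longrightarrow> norm (X m - X n) < \<epsilon> / 3"
      using CauchyD[OF X \<epsilon>] by blast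
    obtain N where N: "\<And>n. n \<ge> N \<Longrightarrow> norm (X n - semigroup_class (Y n)) < \<epsilon> / 3"
      using LIMSEQ_D[OF null \<epsilon>] by auto
    have "norm (semigroup_class (Y m) - semigroup_class (Y n)) < \<epsilon>"
      if "m \<ge> max M N" "n \<ge> max M N" for m n
    proof -
      have "semigroup_class (Y m) - semigroup_class (Y n) =
          (X m - X n) - (X m - semigroup_class (Y m)) + (X n - semigroup_class (Y n))" by simp
      then have "norm (semigroup_class (Y m) - semigroup_class (Y n)) \<le>
          norm (X m - X n) + norm (X m - semigroup_class (Y m)) + norm (X n - semigroup_class (Y n))"
        by (metis norm_triangle_le norm_triangle_ineq4 add_right_mono)
      then show ?thesis using M[of m n] N[of m] N[of n] that by simp
    qed
    then show "\<exists>M. \<forall>m\<ge>M. \<forall>n\<ge>M. norm (semigroup_class (Y m) - semigroup_class (Y n)) < \<epsilon>" by blast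
  qed
  then have "cauchy_seq Y"
    unfolding cauchy_seq_def Cauchy_def dist_norm
    by (simp add: norm_semigroup_class flip: semigroup_class_diff)
  from tendsto_add[OF null cauchy_seq_class_tendsto[OF this]]
  show "convergent X" by (auto simp: convergent_def)
qed

instance semigroup_cstar :: (right_lcm_monoid) cstar_algebra
proof
  fix x y :: "'a semigroup_cstar" and c d :: complex and r :: real
  have mult_left: "(c *\<^sub>C x) * y = c *\<^sub>C (x * y)" for c and x y :: "'a semigroup_cstar"
    by transfer (rule cauchy_rel_eq, auto simp: free_scale_mult_left)
  have mult_right: "x * (c *\<^sub>C y) = c *\<^sub>C (x * y)" for c and x y :: "'a semigroup_cstar"
    by transfer (rule cauchy_rel_eq, auto simp: free_scale_mult_right)
  show "(c *\<^sub>C x) * y = c *\<^sub>C (x * y)" "x * (c *\<^sub>C y) = c *\<^sub>C (x * y)"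
    by (rule mult_left mult_right)+
  show "(r *\<^sub>R x) * y = r *\<^sub>R (x * y)" "x * (r *\<^sub>R y) = r *\<^sub>R (x * y)"
    by (simp_all add: scaleR_semigroup_cstar_def mult_left mult_right)
  show "norm (x * y) \<le> norm x * norm y"
  proof transfer
    fix X Y :: "nat \<Rightarrow> 'a generator free_star_algebra"
    assume "cauchy_rel X X" "cauchy_rel Y Y"
    then have X: "cauchy_seq X" and Y: "cauchy_seq Y" by simp_all
    show "lim (\<lambda>n. semigroup_seminorm (X n * Y n)) \<le>
        lim (\<lambda>n. semigroup_seminorm (X n)) * lim (\<lambda>n. semigroup_seminorm (Y n))"
      using sn(4) by (intro LIMSEQ_le[OF cauchy_seq_norm_tendsto[OF cauchy_seq_mult[OF X Y]]
            tendsto_mult[OF cauchy_seq_norm_tendsto[OF X] cauchy_seq_norm_tendsto[OF Y]]]) blast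
  qed
  show "c *\<^sub>C (x + y) = c *\<^sub>C x + c *\<^sub>C y" "(c + d) *\<^sub>C x = c *\<^sub>C x + d *\<^sub>C x"
    "c *\<^sub>C (d *\<^sub>C x) = (c * d) *\<^sub>C x"
    by (rule semigroup_cstar_scaleC)+
  show "r *\<^sub>R x = of_real r *\<^sub>C x" by (rule scaleR_semigroup_cstar_def)
  show "norm (c *\<^sub>C x) = cmod c * norm x" by (rule semigroup_cstar_norm_scaleC)
  show "(x\<^sup>\<star>)\<^sup>\<star> = x"
    by transfer simp
  show "(x + y)\<^sup>\<star> = x\<^sup>\<star> + y\<^sup>\<star>"
    by transfer (rule cauchy_rel_eq, auto simp: free_star_add)
  show "(c *\<^sub>C x)\<^sup>\<star> = cnj c *\<^sub>C x\<^sup>\<star>"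
    by transfer (rule cauchy_rel_eq, auto simp: free_star_scale)
  show "(x * y)\<^sup>\<star> = y\<^sup>\<star> * x\<^sup>\<star>"
    by transfer (rule cauchy_rel_eq, auto simp: free_star_mult)
  show "norm (x\<^sup>\<star> * x) = (norm x)\<^sup>2"
  proof transfer
    fix X :: "nat \<Rightarrow> 'a generator free_star_algebra"
    assume "cauchy_rel X X"
    then have "(\<lambda>n. (semigroup_seminorm (X n))\<^sup>2) \<longlonglongrightarrow> (lim (\<lambda>n. semigroup_seminorm (X n)))\<^sup>2"
      by (intro tendsto_power cauchy_seq_norm_tendsto) simp
    then show "lim (\<lambda>n. semigroup_seminorm (free_star (X n) * X n)) = (lim (\<lambda>n. semigroup_seminorm (X n)))\<^sup>2"
      by (simp add: sn(5) limI)
  qed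
qed

definition univ_v :: "'a::right_lcm_monoid \<Rightarrow> 'a semigroup_cstar" where
  "univ_v s = semigroup_class (free_v s)"

definition univ_e :: "'a::right_lcm_monoid set \<Rightarrow> 'a semigroup_cstar" where
  "univ_e X = semigroup_class (free_e X)"

lemma univ_star: "semigroup_class (free_star x) = (semigroup_class x)\<^sup>\<star>"
  by (simp add: semigroup_class_def star_semigroup_cstar.abs_eq)

lemma semigroup_relator_class:
  assumes "r \<in> semigroup_relators"
  shows "semigroup_class r = 0"
proof -
  have "semigroup_seminorm r \<le> 0"
    by (rule semigroup_seminorm_least) (use assms in \<open>simp add: relator_zero\<close>)
  then show ?thesis
    using norm_semigroup_class[of r] norm_le_zero_iff[of "semigroup_class r"] by simp
qed

lemma univ_e_selfadjoint:
  assumes "X \<in> constructible_ideals"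
  shows "(univ_e X)\<^sup>\<star> = univ_e X"
proof -
  have "free_star (free_e X) - free_e X \<in> semigroup_relators"
    using assms unfolding semigroup_relators_def by blast
  from semigroup_relator_class[OF this] show ?thesis
    by (simp add: univ_e_def univ_star semigroup_class_diff)
qed


section \<open>Quotients of C*-algebras by closed ideals\<close>

lemma scaleC_one [simp]: "1 *\<^sub>C (x :: 'a::cstar_algebra) = x"
  using scaleR_scaleC[of 1 x] by simp

lemma scaleC_minus_one: "(- 1) *\<^sub>C (x :: 'a::cstar_algebra) = - x"
  using scaleR_scaleC[of "-1" x] by simp

lemma scaleC_zero_right [simp]: "c *\<^sub>C (0 :: 'a::cstar_algebra) = 0"
  using scaleC_add_right[of c 0 "0::'a"] by simp

lemma star_zero [simp]: "(0 :: 'a::cstar_algebra)\<^sup>\<star> = 0"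
  using star_add[of 0 "0::'a"] by simp

lemma star_minus: "(- x :: 'a::cstar_algebra)\<^sup>\<star> = - x\<^sup>\<star>"
  using star_add[of x "- x"] by (simp add: eq_neg_iff_add_eq_0 add.commute)

lemma star_diff: "(x - y :: 'a::cstar_algebra)\<^sup>\<star> = x\<^sup>\<star> - y\<^sup>\<star>"
  using star_add[of x "- y"] by (simp add: star_minus)

lemma star_one [simp]: "(1 :: 'a::cstar_algebra)\<^sup>\<star> = 1"
  using star_mult[of "1::'a" "1\<^sup>\<star>"] by (simp add: star_star)

lemma norm_star: "norm ((x :: 'a::cstar_algebra)\<^sup>\<star>) = norm x"
proof -
  have le: "norm y \<le> norm (y\<^sup>\<star>)" for y :: 'a
    using norm_mult_ineq[of "y\<^sup>\<star>" y] cstar_identity[of y]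
    by (cases "y = 0") (simp_all add: power2_eq_square)
  show ?thesis using le[of x] le[of "x\<^sup>\<star>"] by (simp add: star_star)
qed

lemma norm_one_le: "norm (1 :: 'a::cstar_algebra) \<le> 1"
proof -
  have "norm (1::'a) = norm (1::'a) * norm (1::'a)"
    using cstar_identity[of "1::'a"] by (simp add: power2_eq_square)
  then show ?thesis by (cases "norm (1::'a) = 0") auto
qed

lemma continuous_on_star: "continuous_on UNIV (star :: 'a::cstar_algebra \<Rightarrow> 'a)"
proof (rule continuous_onI)
  fix x :: 'a and e :: real assume "0 < e"
  then show "\<exists>d>0. \<forall>x'\<in>UNIV. dist x' x < d \<longrightarrow> dist (x'\<^sup>\<star>) (x\<^sup>\<star>) \<le> e"
    by (intro exI[of _ e]) (simp add: dist_norm norm_star flip: star_diff)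
qed

lemma closed_ideal_closed_ideal_generated: "closed_ideal (closed_ideal_generated R)"
  unfolding closed_ideal_generated_def closed_ideal_def by (auto intro!: closed_Inter)

lemma closed_ideal_generated_base: "R \<subseteq> closed_ideal_generated R"
  unfolding closed_ideal_generated_def by blast

lemma closed_ideal_star_preimage:
  fixes I :: "'a::cstar_algebra set"
  assumes "closed_ideal I"
  shows "closed_ideal (star -` I)"
proof -
  have "closed (star -` I)"
    using continuous_closed_vimage[of I star] continuous_on_star assms
    by (auto simp: closed_ideal_def continuous_on_eq_continuous_at)
  then show ?thesis
    using assms unfolding closed_ideal_def by (simp add: star_add star_scaleC star_mult)
qed

lemma closed_ideal_generated_star:
  assumes "\<And>r. r \<in> R \<Longrightarrow> r\<^sup>\<star> \<in> R" and "x \<in> closed_ideal_generated R"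
  shows "x\<^sup>\<star> \<in> closed_ideal_generated R"
proof -
  have "R \<subseteq> star -` closed_ideal_generated R"
    using assms(1) closed_ideal_generated_base by blast
  then have "closed_ideal_generated R \<subseteq> star -` closed_ideal_generated R"
    using closed_ideal_star_preimage[OF closed_ideal_closed_ideal_generated[of R]]
    unfolding closed_ideal_generated_def[of R] by (intro Inter_lower) simp
  then show ?thesis using assms(2) by blast
qed

lemma neumann_inverse:
  fixes x :: "'a::cstar_algebra"
  assumes "norm x < 1"
  shows "\<exists>y. (1 - x) * y = 1 \<and> y * (1 - x) = 1"
proof -
  have "\<exists>!y. 1 + x * y = y"
    by (rule banach_fix_type[of "norm x"])
       (use assms norm_mult_ineq in \<open>auto simp: dist_norm simp flip: right_diff_distrib\<close>)
  then obtain y where y: "1 + x * y = y" by blast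
  have "\<exists>!z. 1 + z * x = z"
    by (rule banach_fix_type[of "norm x"])
       (use assms norm_mult_ineq[of _ x] in \<open>auto simp: dist_norm mult.commute[of "norm x"] simp flip: left_diff_distrib\<close>)
  then obtain z where z: "1 + z * x = z" by blast
  have y': "(1 - x) * y = 1" using y by (simp add: left_diff_distrib algebra_simps)
  have z': "z * (1 - x) = 1" using z by (simp add: right_diff_distrib algebra_simps)
  have "z = y" by (metis y' z' mult.assoc mult.left_neutral mult.right_neutral)
  then show ?thesis using y' z' by blast
qed

text \<open>The resolvent \<open>(1 + i s h)\<^sup>-\<^sup>1\<close> of a self-adjoint \<open>h\<close> exists and is a contraction.\<close>

definition resolvent_of :: "'a::cstar_algebra \<Rightarrow> real \<Rightarrow> 'a \<Rightarrow> bool" where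
  "resolvent_of h s r \<longleftrightarrow>
     (1 + (\<i> * of_real s) *\<^sub>C h) * r = 1 \<and> r * (1 + (\<i> * of_real s) *\<^sub>C h) = 1"

lemma resolvent_norm_le:
  fixes h :: "'a::cstar_algebra"
  assumes h: "h\<^sup>\<star> = h" and r: "resolvent_of h s r"
  shows "norm r \<le> 1"
proof -
  define k where "k = 1 + (\<i> * of_real s) *\<^sub>C h"
  have kr: "k * r = 1" "r * k = 1" using r by (auto simp: resolvent_of_def k_def)
  have sk: "k\<^sup>\<star> = 1 - (\<i> * of_real s) *\<^sub>C h"
    using scaleC_minus_one[of "(\<i> * of_real s) *\<^sub>C h"]
    by (simp add: k_def star_add star_scaleC h scaleC_scaleC)
  have rk: "r\<^sup>\<star> * k\<^sup>\<star> = 1" "k\<^sup>\<star> * r\<^sup>\<star> = 1"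
    using kr by (simp_all flip: star_mult)
  have "r + r\<^sup>\<star> = r * (k\<^sup>\<star> + k) * r\<^sup>\<star>"
    using kr rk by (simp add: distrib_left distrib_right mult.assoc)
  also have "k\<^sup>\<star> + k = 1 + 1" by (simp add: sk) (simp add: k_def)
  finally have eq: "r + r\<^sup>\<star> = r * r\<^sup>\<star> + r * r\<^sup>\<star>"
    by (simp add: distrib_left distrib_right)
  have "norm (r * r\<^sup>\<star> + r * r\<^sup>\<star>) = 2 * (norm r)\<^sup>2"
    using cstar_identity[of "r\<^sup>\<star>"] by (simp add: star_star norm_star flip: scaleR_2)
  moreover have "norm (r + r\<^sup>\<star>) \<le> 2 * norm r"
    using norm_triangle_ineq[of r "r\<^sup>\<star>"] by (simp add: norm_star)
  ultimately have "norm r * norm r \<le> 1 * norm r"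
    using eq by (simp add: power2_eq_square)
  then show ?thesis
    by (cases "norm r = 0") (auto dest: mult_right_le_imp_le)
qed

lemma resolvent_step:
  fixes h :: "'a::cstar_algebra"
  assumes h: "h\<^sup>\<star> = h" and r: "resolvent_of h s r" and d: "\<bar>d\<bar> * norm h < 1"
  shows "\<exists>r. resolvent_of h (s + d) r"
proof -
  define k where "k = 1 + (\<i> * of_real s) *\<^sub>C h"
  define k' where "k' = 1 + (\<i> * of_real (s + d)) *\<^sub>C h"
  define x where "x = - ((\<i> * of_real d) *\<^sub>C (r * h))"
  have kr: "k * r = 1" "r * k = 1" using r by (auto simp: resolvent_of_def k_def)
  have k': "k' = k + (\<i> * of_real d) *\<^sub>C h"
    by (simp add: k_def k'_def distrib_left scaleC_add_left)
  have "norm (r * h) \<le> 1 * norm h"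
    by (rule order_trans[OF norm_mult_ineq mult_right_mono[OF resolvent_norm_le[OF h r]]]) simp
  then have "\<bar>d\<bar> * norm (r * h) \<le> \<bar>d\<bar> * norm h"
    by (intro mult_left_mono) auto
  then have "norm x < 1"
    using d by (simp add: x_def norm_scaleC norm_mult)
  then obtain y where y: "(1 - x) * y = 1" "y * (1 - x) = 1" using neumann_inverse by blast
  have "k * (r * h) = h"
    by (metis kr(1) mult.assoc mult.left_neutral)
  then have k'x: "k' = k * (1 - x)"
    by (simp add: k' x_def distrib_left scaleC_mult_right)
  have "k' * (y * r) = 1"
    unfolding k'x by (metis kr(1) mult.assoc mult.left_neutral y(1))
  moreover have "(y * r) * k' = 1"
    unfolding k'x by (metis kr(2) mult.assoc mult.left_neutral y(2))
  ultimately show ?thesis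
    unfolding resolvent_of_def k'_def by blast
qed

lemma resolvent_exists:
  fixes h :: "'a::cstar_algebra"
  assumes h: "h\<^sup>\<star> = h"
  shows "\<exists>r. resolvent_of h s r"
proof -
  obtain N :: nat where N: "\<bar>s\<bar> * norm h < real N"
    using reals_Archimedean2 by blast
  have "0 \<le> \<bar>s\<bar> * norm h" by simp
  with N have N0: "0 < real N" by linarith
  define d where "d = s / real N"
  have d: "\<bar>d\<bar> * norm h < 1" using N N0 by (simp add: d_def field_simps)
  have "\<exists>r. resolvent_of h (real n * d) r" for n
  proof (induction n)
    case 0
    have "0 *\<^sub>C h = 0" using norm_scaleC[of 0 h] by simp
    then show ?case by (intro exI[of _ 1]) (simp add: resolvent_of_def)
  next
    case (Suc n)
    then obtain r where "resolvent_of h (real n * d) r" by blast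
    from resolvent_step[OF h this d] show ?case by (simp add: algebra_simps)
  qed
  from this[of N] show ?thesis using N0 by (simp add: d_def)
qed

context
  fixes I :: "'a::cstar_algebra set"
  assumes ideal: "closed_ideal I"
begin

lemma idealD:
  "closed I" "0 \<in> I" "x \<in> I \<Longrightarrow> y \<in> I \<Longrightarrow> x + y \<in> I" "x \<in> I \<Longrightarrow> c *\<^sub>C x \<in> I"
  "x \<in> I \<Longrightarrow> a * x \<in> I" "x \<in> I \<Longrightarrow> x * a \<in> I"
  using ideal unfolding closed_ideal_def by auto

lemma ideal_minus: "x \<in> I \<Longrightarrow> - x \<in> I"
  using idealD(4)[of x "-1"] by (simp add: scaleC_minus_one)

lemma ideal_diff: "x \<in> I \<Longrightarrow> y \<in> I \<Longrightarrow> x - y \<in> I"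
  using idealD(3)[of x "- y"] ideal_minus[of y] by simp

lemma infdist_ideal_le:
  assumes "i \<in> I"
  shows "infdist x I \<le> norm (x + i)"
  using infdist_le[OF ideal_minus[OF assms], of x] by (simp add: dist_norm)

lemma infdist_ideal_less:
  assumes "infdist x I < e"
  shows "\<exists>i\<in>I. norm (x + i) < e"
proof -
  have "I \<noteq> {}" using idealD(2) by blast
  then obtain j where "j \<in> I" "dist x j < e"
    using assms by (auto simp: infdist_notempty cINF_less_iff)
  then show ?thesis
    by (intro bexI[of _ "- j"]) (auto simp: dist_norm ideal_minus)
qed

lemma infdist_ideal_eq:
  assumes "x - y \<in> I"
  shows "infdist x I = infdist y I"
proof -
  have le: "infdist x I \<le> infdist y I" if "x - y \<in> I" for x y
  proof (rule field_le_epsilon)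
    fix e :: real assume "0 < e"
    then obtain i where i: "i \<in> I" "norm (y + i) < infdist y I + e"
      using infdist_ideal_less[of y "infdist y I + e"] by auto
    then show "infdist x I \<le> infdist y I + e"
      using infdist_ideal_le[OF ideal_diff[OF i(1) that], of x] by (simp add: algebra_simps)
  qed
  have "y - x \<in> I" using ideal_minus[OF assms] by simp
  then show ?thesis using le assms by (metis antisym)
qed

lemma infdist_ideal_zero: "infdist x I = 0 \<longleftrightarrow> x \<in> I"
  using in_closed_iff_infdist_zero[OF idealD(1)] idealD(2) by blast

lemma infdist_ideal_triangle: "infdist (x + y) I \<le> infdist x I + infdist y I"
proof (rule field_le_epsilon)
  fix e :: real assume "0 < e"
  then obtain i j where i: "i \<in> I" "norm (x + i) < infdist x I + e / 2"
    and j: "j \<in> I" "norm (y + j) < infdist y I + e / 2"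
    using infdist_ideal_less[of x "infdist x I + e / 2"]
      infdist_ideal_less[of y "infdist y I + e / 2"] by auto
  have "infdist (x + y) I \<le> norm ((x + i) + (y + j))"
    using infdist_ideal_le[OF idealD(3)[OF i(1) j(1)], of "x + y"] by (simp add: algebra_simps)
  also have "\<dots> \<le> norm (x + i) + norm (y + j)" by (rule norm_triangle_ineq)
  finally show "infdist (x + y) I \<le> infdist x I + infdist y I + e" using i j by linarith
qed

lemma infdist_ideal_scaleC: "infdist (c *\<^sub>C x) I = cmod c * infdist x I"
proof -
  have le: "infdist (c *\<^sub>C x) I \<le> cmod c * infdist x I" if "c \<noteq> 0" for c x
  proof (rule field_le_epsilon)
    fix e :: real assume "0 < e"
    then have "0 < e / cmod c" using that by simp
    then obtain i where i: "i \<in> I" "norm (x + i) < infdist x I + e / cmod c"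
      using infdist_ideal_less[of x "infdist x I + e / cmod c"] by auto
    have "infdist (c *\<^sub>C x) I \<le> norm (c *\<^sub>C x + c *\<^sub>C i)"
      by (rule infdist_ideal_le[OF idealD(4)[OF i(1)]])
    also have "\<dots> = cmod c * norm (x + i)" by (simp add: norm_scaleC flip: scaleC_add_right)
    also have "\<dots> \<le> cmod c * (infdist x I + e / cmod c)"
      using i(2) by (intro mult_left_mono) auto
    also have "\<dots> = cmod c * infdist x I + e" using that by (simp add: distrib_left)
    finally show "infdist (c *\<^sub>C x) I \<le> cmod c * infdist x I + e" .
  qed
  show ?thesis
  proof (cases "c = 0")
    case True
    have "0 *\<^sub>C x = 0" using norm_scaleC[of 0 x] by simp
    then show ?thesis using True idealD(2) by simp
  next
    case False
    have "infdist x I = infdist (inverse c *\<^sub>C (c *\<^sub>C x)) I"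
      using False by (simp add: scaleC_scaleC)
    also have "\<dots> \<le> cmod (inverse c) * infdist (c *\<^sub>C x) I"
      by (rule le) (use False in simp)
    finally have "cmod c * infdist x I \<le> cmod c * (cmod (inverse c) * infdist (c *\<^sub>C x) I)"
      by (intro mult_left_mono) auto
    also have "\<dots> = infdist (c *\<^sub>C x) I"
      using False by (metis mult.assoc mult_1 norm_mult norm_one right_inverse)
    finally show ?thesis using le[OF False, of x] by simp
  qed
qed

lemma infdist_ideal_mult: "infdist (x * y) I \<le> infdist x I * infdist y I"
proof -
  have "infdist (x * y) I \<le> (infdist x I + inverse (Suc n)) * (infdist y I + inverse (Suc n))" for n
  proof -
    obtain i j where i: "i \<in> I" "norm (x + i) < infdist x I + inverse (Suc n)"
      and j: "j \<in> I" "norm (y + j) < infdist y I + inverse (Suc n)"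
      using infdist_ideal_less[of x "infdist x I + inverse (Suc n)"]
        infdist_ideal_less[of y "infdist y I + inverse (Suc n)"] by auto
    have "x * j + i * (y + j) \<in> I" using i j by (intro idealD)
    from infdist_ideal_le[OF this, of "x * y"]
    have "infdist (x * y) I \<le> norm ((x + i) * (y + j))" by (simp add: algebra_simps)
    also have "\<dots> \<le> norm (x + i) * norm (y + j)" by (rule norm_mult_ineq)
    also have "\<dots> \<le> (infdist x I + inverse (Suc n)) * (infdist y I + inverse (Suc n))"
      using i j infdist_nonneg[of x I] by (intro mult_mono) auto
    finally show ?thesis .
  qed
  moreover have "(\<lambda>n. (infdist x I + inverse (Suc n)) * (infdist y I + inverse (Suc n)))
      \<longlonglongrightarrow> (infdist x I + 0) * (infdist y I + 0)"
    by (intro tendsto_intros LIMSEQ_inverse_real_of_nat)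
  ultimately show ?thesis
    by (intro LIMSEQ_le_const[where X = "\<lambda>n. (infdist x I + inverse (Suc n)) * (infdist y I + inverse (Suc n))"]) auto
qed

lemma infdist_ideal_star:
  assumes "\<And>x. x \<in> I \<Longrightarrow> x\<^sup>\<star> \<in> I"
  shows "infdist (x\<^sup>\<star>) I = infdist x I"
proof -
  have le: "infdist (x\<^sup>\<star>) I \<le> infdist x I" for x
  proof (rule field_le_epsilon)
    fix e :: real assume "0 < e"
    then obtain i where i: "i \<in> I" "norm (x + i) < infdist x I + e"
      using infdist_ideal_less[of x "infdist x I + e"] by auto
    have "infdist (x\<^sup>\<star>) I \<le> norm (x\<^sup>\<star> + i\<^sup>\<star>)"
      by (rule infdist_ideal_le[OF assms[OF i(1)]])
    also have "\<dots> = norm (x + i)" by (simp add: norm_star flip: star_add)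
    finally show "infdist (x\<^sup>\<star>) I \<le> infdist x I + e" using i by simp
  qed
  show ?thesis using le[of x] le[of "x\<^sup>\<star>"] by (simp add: star_star)
qed

text \<open>The C*-identity for the quotient norm: for self-adjoint \<open>h \<in> I\<close> the elements
  \<open>1 - (1 + i s h)\<^sup>-\<^sup>1\<close> of \<open>I\<close> play the role of an approximate unit.\<close>

lemma infdist_ideal_cstar_aux:
  assumes "h \<in> I" "h\<^sup>\<star> = h" "s > 0"
  shows "(infdist a I)\<^sup>2 \<le> norm (a\<^sup>\<star> * a + h) + 2 / s"
proof -
  obtain r where r: "resolvent_of h s r" using resolvent_exists[OF assms(2)] by blast
  note n1 = resolvent_norm_le[OF assms(2) r]
  have eq: "r + (\<i> * of_real s) *\<^sub>C (h * r) = 1"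
    using r by (simp add: resolvent_of_def distrib_right scaleC_mult_left)
  then have r1: "(\<i> * of_real s) *\<^sub>C (h * r) = 1 - r" by (simp add: algebra_simps)
  then have "1 - r \<in> I" using idealD(4,6) assms(1) by metis
  then have "- (a * (1 - r)) \<in> I" by (intro ideal_minus idealD(5))
  from infdist_ideal_le[OF this, of a] have "infdist a I \<le> norm (a * r)"
    by (simp add: right_diff_distrib)
  then have "(infdist a I)\<^sup>2 \<le> (norm (a * r))\<^sup>2"
    by (intro power_mono infdist_nonneg)
  also have "\<dots> = norm (r\<^sup>\<star> * (a\<^sup>\<star> * a + h) * r - r\<^sup>\<star> * (h * r))"
    by (simp add: star_mult mult.assoc distrib_left distrib_right flip: cstar_identity)
  also have "\<dots> \<le> norm (r\<^sup>\<star> * (a\<^sup>\<star> * a + h) * r) + norm (r\<^sup>\<star> * (h * r))"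
    by (rule norm_triangle_ineq4)
  also have "norm (r\<^sup>\<star> * (a\<^sup>\<star> * a + h) * r) \<le> (1 * norm (a\<^sup>\<star> * a + h)) * 1"
    using n1 by (intro order_trans[OF norm_mult_ineq] mult_mono) (auto simp: norm_star)
  also have "norm (r\<^sup>\<star> * (h * r)) \<le> 1 * norm (h * r)"
    using n1 by (intro order_trans[OF norm_mult_ineq mult_right_mono]) (auto simp: norm_star)
  also have "norm (h * r) \<le> 2 / s"
  proof -
    have "s * norm (h * r) = norm (1 - r)"
      unfolding r1[symmetric] using assms(3) by (simp add: norm_scaleC norm_mult)
    also have "\<dots> \<le> 2"
      using norm_triangle_ineq4[of 1 r] n1 norm_one_le[where 'a = 'a] by linarith
    finally show ?thesis using assms(3) by (simp add: field_simps)
  qed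
  finally show ?thesis by simp
qed

lemma infdist_ideal_cstar:
  assumes st: "\<And>x. x \<in> I \<Longrightarrow> x\<^sup>\<star> \<in> I"
  shows "infdist (a\<^sup>\<star> * a) I = (infdist a I)\<^sup>2"
proof (rule antisym)
  show "infdist (a\<^sup>\<star> * a) I \<le> (infdist a I)\<^sup>2"
    using infdist_ideal_mult[of "a\<^sup>\<star>" a] infdist_ideal_star[OF st] by (simp add: power2_eq_square)
  show "(infdist a I)\<^sup>2 \<le> infdist (a\<^sup>\<star> * a) I"
  proof (rule field_le_epsilon)
    fix e :: real assume "0 < e"
    then obtain i where i: "i \<in> I" "norm (a\<^sup>\<star> * a + i) < infdist (a\<^sup>\<star> * a) I + e / 2"
      using infdist_ideal_less[of "a\<^sup>\<star> * a" "infdist (a\<^sup>\<star> * a) I + e / 2"] by auto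
    define h where "h = (1/2) *\<^sub>C (i + i\<^sup>\<star>)"
    have h: "h \<in> I" "h\<^sup>\<star> = h"
      unfolding h_def using i(1) st by (auto intro!: idealD simp: star_scaleC star_add star_star add.commute)
    have half: "x = (1/2) *\<^sub>C (x + x)" for x :: 'a
      by (simp add: scaleC_add_right flip: scaleC_add_left)
    have "a\<^sup>\<star> * a + h = (1/2) *\<^sub>C ((a\<^sup>\<star> * a + i) + (a\<^sup>\<star> * a + i)\<^sup>\<star>)"
      using half[of "a\<^sup>\<star> * a"] by (simp add: h_def scaleC_add_right star_add star_mult star_star algebra_simps)
    then have "norm (a\<^sup>\<star> * a + h) = norm ((a\<^sup>\<star> * a + i) + (a\<^sup>\<star> * a + i)\<^sup>\<star>) / 2"
      by (simp add: norm_scaleC)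
    then have "norm (a\<^sup>\<star> * a + h) \<le> norm (a\<^sup>\<star> * a + i)"
      using norm_triangle_ineq[of "a\<^sup>\<star> * a + i" "(a\<^sup>\<star> * a + i)\<^sup>\<star>"] by (simp add: norm_star)
    moreover have "2 / (4 / e) = e / 2" by simp
    ultimately show "(infdist a I)\<^sup>2 \<le> infdist (a\<^sup>\<star> * a) I + e"
      using infdist_ideal_cstar_aux[OF h, of "4 / e" a] i(2) \<open>0 < e\<close> by simp
  qed
qed

end


section \<open>The boundary quotient\<close>

text \<open>The factors of \<open>\<Prod>\<^bsub>s\<in>F\<^esub> (1 - e\<^bsub>sS\<^esub>)\<close> commute, but the algebra does not. The product is therefore
  taken along an enumeration of \<open>F\<close>, and all enumerations are admitted.\<close>

definition boundary_relators :: "'a::right_lcm_monoid semigroup_cstar set" where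
  "boundary_relators =
     {prod_list (map (\<lambda>s. 1 - univ_e (right_ideal s)) xs) | xs. distinct xs \<and> foundation_set (set xs)}"

definition accurate_relators :: "'a::right_lcm_monoid semigroup_cstar set" where
  "accurate_relators =
     {(\<Sum>s\<in>F. univ_e (right_ideal s)) - 1 | F. accurate_foundation_set F}"

definition boundary_ideal :: "'a::right_lcm_monoid semigroup_cstar set" where
  "boundary_ideal = closed_ideal_generated boundary_relators"

lemma closed_ideal_boundary_ideal: "closed_ideal boundary_ideal"
  unfolding boundary_ideal_def by (rule closed_ideal_closed_ideal_generated)

lemmas bi = idealD[OF closed_ideal_boundary_ideal]
lemmas bi_minus = ideal_minus[OF closed_ideal_boundary_ideal]

lemma star_prod_list:
  "(prod_list (xs :: 'a::cstar_algebra list))\<^sup>\<star> = prod_list (rev (map star xs))"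
  by (induction xs) (simp_all add: star_mult)

lemma boundary_relators_star: "r \<in> boundary_relators \<Longrightarrow> r\<^sup>\<star> \<in> boundary_relators"
proof -
  assume "r \<in> boundary_relators"
  then obtain xs where xs: "distinct xs" "foundation_set (set xs)"
    and r: "r = prod_list (map (\<lambda>s. 1 - univ_e (right_ideal s)) xs)"
    unfolding boundary_relators_def by blast
  have "(univ_e (right_ideal s))\<^sup>\<star> = univ_e (right_ideal s)" for s :: 'a
    by (rule univ_e_selfadjoint) (auto simp: constructible_ideals_def)
  then have "r\<^sup>\<star> = prod_list (map (\<lambda>s. 1 - univ_e (right_ideal s)) (rev xs))"
    by (simp add: r star_prod_list o_def star_diff rev_map)
  then show ?thesis
    unfolding boundary_relators_def using xs by (intro CollectI exI[of _ "rev xs"]) simp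
qed

lemma bi_star: "x \<in> boundary_ideal \<Longrightarrow> x\<^sup>\<star> \<in> boundary_ideal"
  unfolding boundary_ideal_def using closed_ideal_generated_star boundary_relators_star by blast

definition boundary_equiv :: "'a::right_lcm_monoid semigroup_cstar \<Rightarrow> 'a semigroup_cstar \<Rightarrow> bool" where
  "boundary_equiv x y \<longleftrightarrow> x - y \<in> boundary_ideal"

lemma boundary_equiv_trans:
  "boundary_equiv x y \<Longrightarrow> boundary_equiv y z \<Longrightarrow> boundary_equiv x z"
  unfolding boundary_equiv_def using bi(3)[of "x - y" "y - z"] by simp

lemma boundary_equiv_sym: "boundary_equiv x y \<Longrightarrow> boundary_equiv y x"
  unfolding boundary_equiv_def using bi_minus[of "x - y"] by simp

lemma boundary_equiv_refl [simp]: "boundary_equiv x x"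
  by (simp add: boundary_equiv_def bi(2))

lemma boundary_equiv_equivp: "equivp boundary_equiv"
  by (intro equivpI reflpI sympI transpI boundary_equiv_refl)
     (fact boundary_equiv_sym boundary_equiv_trans)+

quotient_type (overloaded) 'a boundary_quotient = "'a::right_lcm_monoid semigroup_cstar" / boundary_equiv
  by (rule boundary_equiv_equivp)

instantiation boundary_quotient :: (right_lcm_monoid) ab_group_add
begin

lift_definition zero_boundary_quotient :: "'a boundary_quotient" is 0 .

lift_definition plus_boundary_quotient ::
  "'a boundary_quotient \<Rightarrow> 'a boundary_quotient \<Rightarrow> 'a boundary_quotient" is "(+)"
proof -
  fix x x' y y' :: "'a semigroup_cstar"
  assume "boundary_equiv x x'" "boundary_equiv y y'"
  then have "(x - x') + (y - y') \<in> boundary_ideal"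
    unfolding boundary_equiv_def by (rule bi(3))
  then show "boundary_equiv (x + y) (x' + y')"
    unfolding boundary_equiv_def by (simp add: algebra_simps)
qed

lift_definition uminus_boundary_quotient :: "'a boundary_quotient \<Rightarrow> 'a boundary_quotient" is uminus
proof -
  fix x y :: "'a semigroup_cstar"
  assume "boundary_equiv x y"
  then have "- (x - y) \<in> boundary_ideal"
    unfolding boundary_equiv_def by (rule bi_minus)
  then show "boundary_equiv (- x) (- y)"
    unfolding boundary_equiv_def by (simp add: algebra_simps)
qed

lift_definition minus_boundary_quotient ::
  "'a boundary_quotient \<Rightarrow> 'a boundary_quotient \<Rightarrow> 'a boundary_quotient" is "(-)"
proof -
  fix x x' y y' :: "'a semigroup_cstar"
  assume "boundary_equiv x x'" "boundary_equiv y y'"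
  then have "(x - x') - (y - y') \<in> boundary_ideal"
    unfolding boundary_equiv_def by (rule ideal_diff[OF closed_ideal_boundary_ideal])
  then show "boundary_equiv (x - y) (x' - y')"
    unfolding boundary_equiv_def by (simp add: algebra_simps)
qed

instance
  by standard (transfer, simp add: algebra_simps)+

end

instantiation boundary_quotient :: (right_lcm_monoid) "{ring, monoid_mult}"
begin

lift_definition one_boundary_quotient :: "'a boundary_quotient" is 1 .

lift_definition times_boundary_quotient ::
  "'a boundary_quotient \<Rightarrow> 'a boundary_quotient \<Rightarrow> 'a boundary_quotient" is "(*)"
proof -
  fix x x' y y' :: "'a semigroup_cstar"
  assume "boundary_equiv x x'" "boundary_equiv y y'"
  then have "(x - x') * y + x' * (y - y') \<in> boundary_ideal"
    unfolding boundary_equiv_def by (intro bi)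
  then show "boundary_equiv (x * y) (x' * y')"
    unfolding boundary_equiv_def by (simp add: algebra_simps)
qed

instance
  by standard (transfer, simp add: algebra_simps)+

end

instantiation boundary_quotient :: (right_lcm_monoid) "{scaleC, involution, real_vector}"
begin

lift_definition scaleC_boundary_quotient :: "complex \<Rightarrow> 'a boundary_quotient \<Rightarrow> 'a boundary_quotient"
  is "\<lambda>c x. c *\<^sub>C x"
proof -
  fix c and x y :: "'a semigroup_cstar"
  assume "boundary_equiv x y"
  then have "c *\<^sub>C (x - y) \<in> boundary_ideal" unfolding boundary_equiv_def by (rule bi)
  moreover have "c *\<^sub>C x = c *\<^sub>C (x - y) + c *\<^sub>C y" by (simp flip: scaleC_add_right)
  ultimately show "boundary_equiv (c *\<^sub>C x) (c *\<^sub>C y)" by (simp add: boundary_equiv_def)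
qed

lift_definition star_boundary_quotient :: "'a boundary_quotient \<Rightarrow> 'a boundary_quotient" is star
  unfolding boundary_equiv_def by (simp add: bi_star flip: star_diff)

lift_definition scaleR_boundary_quotient :: "real \<Rightarrow> 'a boundary_quotient \<Rightarrow> 'a boundary_quotient"
  is "\<lambda>r x. r *\<^sub>R x"
  unfolding boundary_equiv_def by (metis bi(4) scaleR_right_diff_distrib scaleR_scaleC)

instance
  by standard (transfer, simp add: scaleR_add_right scaleR_add_left)+

end

instantiation boundary_quotient :: (right_lcm_monoid) real_normed_vector
begin

lift_definition norm_boundary_quotient :: "'a boundary_quotient \<Rightarrow> real"
  is "\<lambda>x. infdist x boundary_ideal"
  unfolding boundary_equiv_def by (rule infdist_ideal_eq[OF closed_ideal_boundary_ideal])

definition dist_boundary_quotient :: "'a boundary_quotient \<Rightarrow> 'a boundary_quotient \<Rightarrow> real" where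
  "dist_boundary_quotient x y = norm (x - y)"

definition sgn_boundary_quotient :: "'a boundary_quotient \<Rightarrow> 'a boundary_quotient" where
  "sgn_boundary_quotient x = x /\<^sub>R norm x"

definition uniformity_boundary_quotient :: "('a boundary_quotient \<times> 'a boundary_quotient) filter" where
  [code del]: "uniformity_boundary_quotient = (INF e\<in>{0 <..}. principal {(x, y). dist x y < e})"

definition open_boundary_quotient :: "'a boundary_quotient set \<Rightarrow> bool" where
  [code del]: "open_boundary_quotient U \<longleftrightarrow>
     (\<forall>x\<in>U. eventually (\<lambda>(x', y). x' = x \<longrightarrow> y \<in> U) uniformity)"

instance
proof
  fix x y :: "'a boundary_quotient" and a :: real
  show "dist x y = norm (x - y)" by (rule dist_boundary_quotient_def)
  show "sgn x = x /\<^sub>R norm x" by (rule sgn_boundary_quotient_def)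
  show "uniformity = (INF e\<in>{0 <..}. principal {(x, y). dist x y < (e::real)} ::
      ('a boundary_quotient \<times> 'a boundary_quotient) filter)"
    by (rule uniformity_boundary_quotient_def)
  show "open U \<longleftrightarrow> (\<forall>x\<in>U. eventually (\<lambda>(x', y). x' = x \<longrightarrow> y \<in> U) uniformity)"
    for U :: "'a boundary_quotient set"
    by (rule open_boundary_quotient_def)
  show "norm x = 0 \<longleftrightarrow> x = 0"
    by transfer (simp add: infdist_ideal_zero[OF closed_ideal_boundary_ideal] boundary_equiv_def)
  show "norm (x + y) \<le> norm x + norm y"
    by transfer (rule infdist_ideal_triangle[OF closed_ideal_boundary_ideal])
  show "norm (a *\<^sub>R x) = \<bar>a\<bar> * norm x"
    by transfer (simp add: infdist_ideal_scaleC[OF closed_ideal_boundary_ideal] scaleR_scaleC)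
qed

end

definition boundary_map :: "'a::right_lcm_monoid semigroup_cstar \<Rightarrow> 'a boundary_quotient" where
  "boundary_map = abs_boundary_quotient"

lemma boundary_map_add: "boundary_map (x + y) = boundary_map x + boundary_map y"
  by (simp add: boundary_map_def plus_boundary_quotient.abs_eq)

lemma boundary_map_zero: "boundary_map 0 = 0"
  by (simp add: boundary_map_def zero_boundary_quotient_def)

lemma boundary_map_sum: "boundary_map (\<Sum>i\<in>A. f i) = (\<Sum>i\<in>A. boundary_map (f i))"
  by (induction A rule: infinite_finite_induct) (simp_all add: boundary_map_add boundary_map_zero)

lemma boundary_map_diff: "boundary_map (x - y) = boundary_map x - boundary_map y"
  by (simp add: boundary_map_def minus_boundary_quotient.abs_eq)

lemma norm_boundary_map: "norm (boundary_map x) = infdist x boundary_ideal"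
  by (simp add: boundary_map_def norm_boundary_quotient.abs_eq)

lemma norm_boundary_map_le: "norm (boundary_map x) \<le> norm x"
  unfolding norm_boundary_map using infdist_ideal_le[OF closed_ideal_boundary_ideal bi(2), of x] by simp

lemma boundary_map_eq_iff: "boundary_map x = boundary_map y \<longleftrightarrow> x - y \<in> boundary_ideal"
  by (simp add: boundary_map_def boundary_quotient.abs_eq_iff boundary_equiv_def)

lemma boundary_map_lift:
  assumes "norm z < e"
  shows "\<exists>x. boundary_map x = z \<and> norm x < e"
proof -
  obtain w where w: "boundary_map w = z"
    by (metis boundary_map_def Quotient_abs_rep[OF Quotient_boundary_quotient])
  with assms obtain i where "i \<in> boundary_ideal" "norm (w + i) < e"
    using infdist_ideal_less[OF closed_ideal_boundary_ideal] norm_boundary_map by metis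
  then show ?thesis
    using w boundary_map_eq_iff[of "w + i" w] by (intro exI[of _ "w + i"]) simp
qed

instance boundary_quotient :: (right_lcm_monoid) banach
proof
  fix X :: "nat \<Rightarrow> 'a boundary_quotient"
  assume X: "Cauchy X"
  have "\<exists>M. \<forall>m\<ge>M. \<forall>n\<ge>M. norm (X m - X n) < (1/2)^k" for k
    using CauchyD[OF X, of "(1/2)^k"] by simp
  then obtain M where M: "\<And>k m n. m \<ge> M k \<Longrightarrow> n \<ge> M k \<Longrightarrow> norm (X m - X n) < (1/2)^k"
    by metis
  define r where "r k = (\<Sum>i\<le>k. M i) + k" for k
  have mono: "strict_mono r" by (rule strict_monoI_Suc) (simp add: r_def)
  have rM: "r k \<ge> M k" for k by (simp add: r_def) (metis member_le_sum[of k "{..k}" M] atMost_iff finite_atMost le_add1 order.refl order.trans zero_le)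
  have "norm (X (r (Suc k)) - X (r k)) < (1/2)^k" for k
    using M[of k "r (Suc k)" "r k"] rM[of k] strict_monoD[OF mono, of k "Suc k"] by simp
  then have "\<exists>y. boundary_map y = X (r (Suc k)) - X (r k) \<and> norm y < (1/2)^k" for k
    using boundary_map_lift by blast
  then obtain y where y: "\<And>k. boundary_map (y k) = X (r (Suc k)) - X (r k)"
    and ny: "\<And>k. norm (y k) < (1/2)^k" by metis
  have "summable y"
    by (rule summable_comparison_test'[of "\<lambda>k. (1/2)^k" 0]) (auto intro: less_imp_le[OF ny])
  then obtain s where "(\<lambda>n. \<Sum>k<n. y k) \<longlonglongrightarrow> s" by (auto simp: summable_def sums_def)
  then have "(\<lambda>n. norm ((\<Sum>k<n. y k) - s)) \<longlonglongrightarrow> 0"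
    using LIM_zero tendsto_norm_zero by blast
  then have "(\<lambda>n. boundary_map ((\<Sum>k<n. y k) - s)) \<longlonglongrightarrow> 0"
    by (rule Lim_null_comparison[rotated]) (simp add: norm_boundary_map_le)
  moreover have "boundary_map (\<Sum>k<n. y k) = X (r n) - X (r 0)" for n
    by (induction n) (simp_all add: boundary_map_add boundary_map_zero y)
  ultimately have "(\<lambda>n. (X (r n) - X (r 0) - boundary_map s) + (X (r 0) + boundary_map s))
      \<longlonglongrightarrow> 0 + (X (r 0) + boundary_map s)"
    by (intro tendsto_add tendsto_const) (simp add: boundary_map_diff)
  then have "(X \<circ> r) \<longlonglongrightarrow> X (r 0) + boundary_map s" by (simp add: o_def)
  from Cauchy_converges_subseq[OF X mono this] show "convergent X" by (auto simp: convergent_def)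
qed

instance boundary_quotient :: (right_lcm_monoid) cstar_algebra
proof
  fix x y :: "'a boundary_quotient" and c d :: complex and r :: real
  show "(r *\<^sub>R x) * y = r *\<^sub>R (x * y)" "x * (r *\<^sub>R y) = r *\<^sub>R (x * y)"
    by (transfer, simp)+
  show "norm (x * y) \<le> norm x * norm y"
    by transfer (rule infdist_ideal_mult[OF closed_ideal_boundary_ideal])
  show "c *\<^sub>C (x + y) = c *\<^sub>C x + c *\<^sub>C y"
    by transfer (simp add: scaleC_add_right)
  show "(c + d) *\<^sub>C x = c *\<^sub>C x + d *\<^sub>C x"
    by transfer (simp add: scaleC_add_left)
  show "c *\<^sub>C (d *\<^sub>C x) = (c * d) *\<^sub>C x"
    by transfer (simp add: scaleC_scaleC)
  show "r *\<^sub>R x = of_real r *\<^sub>C x"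
    by transfer (simp add: scaleR_scaleC)
  show "(c *\<^sub>C x) * y = c *\<^sub>C (x * y)"
    by transfer (simp add: scaleC_mult_left)
  show "x * (c *\<^sub>C y) = c *\<^sub>C (x * y)"
    by transfer (simp add: scaleC_mult_right)
  show "norm (c *\<^sub>C x) = cmod c * norm x"
    by transfer (rule infdist_ideal_scaleC[OF closed_ideal_boundary_ideal])
  show "(x\<^sup>\<star>)\<^sup>\<star> = x"
    by transfer (simp add: star_star)
  show "(x + y)\<^sup>\<star> = x\<^sup>\<star> + y\<^sup>\<star>"
    by transfer (simp add: star_add)
  show "(c *\<^sub>C x)\<^sup>\<star> = cnj c *\<^sub>C x\<^sup>\<star>"
    by transfer (simp add: star_scaleC)
  show "(x * y)\<^sup>\<star> = y\<^sup>\<star> * x\<^sup>\<star>"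
    by transfer (simp add: star_mult)
  show "norm (x\<^sup>\<star> * x) = (norm x)\<^sup>2"
    by transfer (rule infdist_ideal_cstar[OF closed_ideal_boundary_ideal bi_star])
qed

definition boundary_v :: "'a::right_lcm_monoid \<Rightarrow> 'a boundary_quotient" where
  "boundary_v s = boundary_map (univ_v s)"

definition boundary_e :: "'a::right_lcm_monoid set \<Rightarrow> 'a boundary_quotient" where
  "boundary_e X = boundary_map (univ_e X)"

definition accurate_sum_relation :: "('a::right_lcm_monoid set \<Rightarrow> 'b::cstar_algebra) \<Rightarrow> bool" where
  "accurate_sum_relation e \<longleftrightarrow>
     (\<forall>F. accurate_foundation_set F \<longrightarrow> (\<Sum>s\<in>F. e (right_ideal s)) = 1)"

end

theory Submission
  imports Defs
begin

text \<open>For an accurate foundation set \<open>F\<close> the projections \<open>e\<^bsub>sS\<^esub>\<close>, \<open>s \<in> F\<close>, are mutually orthogonal, so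
  \<open>\<Prod>\<^bsub>s\<in>F\<^esub> (1 - e\<^bsub>sS\<^esub>) = 1 - \<Sum>\<^bsub>s\<in>F\<^esub> e\<^bsub>sS\<^esub>\<close>. Conversely, if \<open>F\<^sub>a\<close> is an accurate refinement of a
  foundation set \<open>F\<close>, then \<open>\<Prod>\<^bsub>s\<in>F\<^esub> (1 - e\<^bsub>sS\<^esub>)\<close> annihilates every \<open>e\<^bsub>tS\<^esub>\<close> with \<open>t \<in> F\<^sub>a\<close>, hence lies in the
  ideal generated by \<open>\<Sum>\<^bsub>t\<in>F\<^sub>a\<^esub> e\<^bsub>tS\<^esub> - 1\<close>. So both families of relations generate the same closed ideal.
  *-homomorphisms are not assumed continuous; they are bounded because a self-adjoint \<open>h\<close> with
  \<open>\<parallel>h\<parallel> \<le> 1/2\<close> is the real part of a unitary, whose image is a contraction.\<close>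

section \<open>Continuity of *-homomorphisms\<close>

lemma star_homD:
  assumes "star_hom \<phi>"
  shows "\<phi> (x + y) = \<phi> x + \<phi> y" "\<phi> (c *\<^sub>C x) = c *\<^sub>C \<phi> x"
    "\<phi> (x * y) = \<phi> x * \<phi> y" "\<phi> (x\<^sup>\<star>) = (\<phi> x)\<^sup>\<star>"
  using assms unfolding star_hom_def by blast+

text \<open>The element \<open>b\<close> is a square root of \<open>1 - h * h\<close>, which makes
  \<open>h + \<i> *\<^sub>C b\<close> unitary. A contraction replaces functional calculus. Being
  self-adjoint and commuting with \<open>h\<close> are closed conditions that the iteration
  preserves, so they are built into its domain \<open>D\<close>.\<close>

lemma self_adjoint_unitary_completion:
  fixes h :: "'a::cstar_algebra"
  assumes sa: "h\<^sup>\<star> = h" and h: "norm h \<le> 1/2"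
  shows "\<exists>b. b\<^sup>\<star> = b \<and> b * h = h * b \<and> h * h + b * b = 1"
proof -
  \<comment> \<open>With \<open>b = 1 - y\<close> the equation \<open>h\<^sup>2 + b\<^sup>2 = 1\<close> becomes the fixed point equation \<open>y = (h\<^sup>2 + y\<^sup>2) / 2\<close>.\<close>
  define D where "D = {y::'a. y\<^sup>\<star> = y} \<inter> {y. y * h = h * y} \<inter> cball 0 (1/2)"
  define f where "f y = (1/2) *\<^sub>R (h * h + y * y)" for y
  have "closed {y::'a. y\<^sup>\<star> = y}" "closed {y. y * h = h * y}"
    by (intro closed_Collect_eq continuous_on_star continuous_intros)+
  then have "complete D"
    unfolding D_def complete_eq_closed by (intro closed_Int) auto
  moreover have "0 \<in> D" by (simp add: D_def)
  then have "D \<noteq> {}" by blast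
  moreover have "f ` D \<subseteq> D"
  proof clarify
    fix y assume "y \<in> D"
    then have y: "y\<^sup>\<star> = y" "y * h = h * y" "norm y \<le> 1/2" by (auto simp: D_def)
    have "norm (h * h + y * y) \<le> norm h * norm h + norm y * norm y"
      by (intro norm_triangle_le add_mono norm_mult_ineq)
    also have "\<dots> \<le> 1/2 * (1/2) + 1/2 * (1/2)"
      by (intro add_mono mult_mono h y) auto
    finally have "norm (f y) \<le> 1/2" by (simp add: f_def)
    moreover have "f y * h = h * f y"
      by (simp add: f_def distrib_left distrib_right) (metis mult.assoc y(2))
    moreover have "(f y)\<^sup>\<star> = f y"
      by (simp add: f_def scaleR_scaleC star_scaleC star_add star_mult sa y(1))
    ultimately show "f y \<in> D" by (simp add: D_def)
  qed
  \<comment> \<open>As \<open>y\<close> and \<open>z\<close> need not commute,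
    \<open>y * y - z * z\<close> is split as \<open>(y - z) * y + z * (y - z)\<close>. The radius
    1/2 of the ball and the factor 1/2 in \<open>f\<close> then give the contraction constant
    1/2.\<close>
  moreover have "dist (f y) (f z) \<le> 1/2 * dist y z" if "y \<in> D" "z \<in> D" for y z
  proof -
    have "norm ((y - z) * y + z * (y - z)) \<le> norm (y - z) * norm y + norm z * norm (y - z)"
      by (intro norm_triangle_le add_mono norm_mult_ineq)
    also have "\<dots> \<le> norm (y - z) * (1/2) + 1/2 * norm (y - z)"
      using that by (intro add_mono mult_left_mono mult_right_mono) (auto simp: D_def)
    also have "(y - z) * y + z * (y - z) = y * y - z * z" by (simp add: algebra_simps)
    finally have "norm (y * y - z * z) \<le> norm (y - z)" by simp
    moreover have "f y - f z = (1/2) *\<^sub>R (y * y - z * z)"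
      by (simp add: f_def algebra_simps)
    ultimately show ?thesis by (simp add: dist_norm)
  qed
  ultimately have "\<exists>!y\<in>D. f y = y"
    by (intro Banach_fix[of D "1/2" f]) auto
  then obtain y where y: "y \<in> D" "f y = y" by blast
  have "h * h + y * y = 2 *\<^sub>R f y" by (simp add: f_def)
  then have "h * h + y * y = y + y" by (simp add: y(2) scaleR_2)
  then have "h * h + (1 - y) * (1 - y) = 1" by (simp add: algebra_simps)
  moreover have "(1 - y)\<^sup>\<star> = 1 - y" "(1 - y) * h = h * (1 - y)"
    using y(1) by (auto simp: D_def star_diff algebra_simps)
  ultimately show ?thesis by blast
qed

text \<open>A \<open>star_hom\<close> need not be unital, so \<open>\<phi> 1\<close> is only a
  projection. Its norm is 0 or 1, and the C*-identity bounds \<open>\<phi> u\<close> by it.\<close>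

lemma norm_star_hom_unitary:
  assumes \<phi>: "star_hom \<phi>" and u: "u\<^sup>\<star> * u = 1"
  shows "norm (\<phi> u) \<le> 1"
proof -
  have one: "(norm (\<phi> 1))\<^sup>2 = norm (\<phi> 1)"
    using cstar_identity[of "\<phi> 1"] by (simp flip: star_homD[OF \<phi>])
  have "norm (\<phi> 1) \<le> 1"
    using one by (cases "norm (\<phi> 1) = 0") (auto simp: power2_eq_square)
  then have "(norm (\<phi> u))\<^sup>2 \<le> 1\<^sup>2"
    using cstar_identity[of "\<phi> u"] by (simp add: u flip: star_homD[OF \<phi>])
  then show ?thesis by (rule power2_le_imp_le) simp
qed

text \<open>Twice \<open>h\<close> is \<open>u + u\<^sup>\<star>\<close> for a unitary
  \<open>u\<close>, and both summands have images of norm at most 1.\<close>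

lemma norm_star_hom_self_adjoint:
  assumes \<phi>: "star_hom \<phi>" and sa: "h\<^sup>\<star> = h" and h: "norm h \<le> 1/2"
  shows "norm (\<phi> h) \<le> 1"
proof -
  obtain b where b: "b\<^sup>\<star> = b" "b * h = h * b" "h * h + b * b = 1"
    using self_adjoint_unitary_completion[OF sa h] by blast
  define u where "u = h + \<i> *\<^sub>C b"
  have us: "u\<^sup>\<star> = h + (- \<i>) *\<^sub>C b"
    by (simp add: u_def star_add star_scaleC sa b(1))
  have bb: "\<i> *\<^sub>C x + (- \<i>) *\<^sub>C x = 0" for x :: 'a
    by (metis add.right_inverse scaleC_add_left scaleR_scaleC of_real_0 scaleR_zero_left)
  have "(h + (- \<i>) *\<^sub>C b) * (h + \<i> *\<^sub>C b) =
      h * h + b * b + (\<i> *\<^sub>C (h * b) + (- \<i>) *\<^sub>C (h * b))"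
    by (simp add: distrib_left distrib_right scaleC_mult_left scaleC_mult_right scaleC_add_right
        scaleC_scaleC b(2) add_ac)
  then have u: "u\<^sup>\<star> * u = 1" by (simp only: b(3) bb add_0_right flip: us u_def)
  have "h + h = u + u\<^sup>\<star>" unfolding us by (simp add: u_def add_ac bb)
  then have "\<phi> h + \<phi> h = \<phi> u + (\<phi> u)\<^sup>\<star>" by (simp flip: star_homD[OF \<phi>])
  then have "2 *\<^sub>R \<phi> h = \<phi> u + (\<phi> u)\<^sup>\<star>" by (simp add: scaleR_2)
  then have "2 * norm (\<phi> h) \<le> norm (\<phi> u) + norm (\<phi> u)"
    by (metis norm_scaleR norm_star norm_triangle_ineq abs_numeral)
  then show ?thesis using norm_star_hom_unitary[OF \<phi> u] by simp
qed

text \<open>Rescaling a self-adjoint \<open>h\<close> to norm 1/2 gives the bound 2 on self-adjoint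
  elements. The C*-identity carries it over to all \<open>x\<close> through
  \<open>x\<^sup>\<star> * x\<close>. The constant is not sharp; only continuity matters
  below.\<close>

lemma star_hom_bounded_linear:
  assumes \<phi>: "star_hom \<phi>"
  shows "bounded_linear \<phi>"
proof (rule bounded_linear_intro)
  show "\<phi> (x + y) = \<phi> x + \<phi> y" for x y by (rule star_homD[OF \<phi>])
  show sc: "\<phi> (r *\<^sub>R x) = r *\<^sub>R \<phi> x" for r x by (simp add: scaleR_scaleC star_homD[OF \<phi>])
  have sa: "norm (\<phi> h) \<le> 2 * norm h" if "h\<^sup>\<star> = h" for h
  proof (cases "h = 0")
    case True
    then show ?thesis using sc[of 0 0] by simp
  next
    case False
    let ?r = "inverse (2 * norm h)"
    have "norm (\<phi> (?r *\<^sub>R h)) \<le> 1"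
      using False that
      by (intro norm_star_hom_self_adjoint[OF \<phi>]) (simp_all add: scaleR_scaleC[of _ h] star_scaleC norm_scaleC norm_mult norm_inverse)
    then show ?thesis using False by (simp add: sc field_simps)
  qed
  show "norm (\<phi> x) \<le> norm x * 2" for x
  proof (rule power2_le_imp_le)
    have "(norm (\<phi> x))\<^sup>2 = norm (\<phi> (x\<^sup>\<star> * x))"
      using cstar_identity[of "\<phi> x"] by (simp flip: star_homD[OF \<phi>])
    also have "\<dots> \<le> 2 * norm (x\<^sup>\<star> * x)" by (rule sa) (simp add: star_mult star_star)
    also have "\<dots> \<le> (norm x * 2)\<^sup>2" by (simp add: cstar_identity power2_eq_square)
    finally show "(norm (\<phi> x))\<^sup>2 \<le> (norm x * 2)\<^sup>2" .
  qed simp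
qed

lemma star_hom_continuous_on: "star_hom \<phi> \<Longrightarrow> continuous_on UNIV \<phi>"
  by (rule bounded_linear.continuous_on[OF star_hom_bounded_linear continuous_on_id])

lemmas star_hom_zero = linear_simps(3)[OF star_hom_bounded_linear]
lemmas star_hom_diff = linear_simps(2)[OF star_hom_bounded_linear]

lemma star_hom_sum: "star_hom \<phi> \<Longrightarrow> \<phi> (\<Sum>i\<in>A. g i) = (\<Sum>i\<in>A. \<phi> (g i))"
  by (rule linear_sum[OF bounded_linear.linear[OF star_hom_bounded_linear]])

section \<open>Kernels, preimages and generating sets under *-homomorphisms\<close>

lemma closed_ideal_kernel:
  assumes "star_hom \<phi>"
  shows "closed_ideal {x. \<phi> x = 0}"
proof -
  have "closed {x. \<phi> x = 0}"
    by (intro closed_Collect_eq star_hom_continuous_on assms continuous_on_const)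
  then show ?thesis
    by (simp add: closed_ideal_def star_homD[OF assms] star_hom_zero[OF assms])
qed

lemma closed_ideal_generated_least:
  "closed_ideal I \<Longrightarrow> R \<subseteq> I \<Longrightarrow> closed_ideal_generated R \<subseteq> I"
  unfolding closed_ideal_generated_def by blast

lemma cstar_subalgebra_vimage:
  assumes "star_hom \<phi>" "cstar_subalgebra B"
  shows "cstar_subalgebra (\<phi> -` B)"
proof -
  have "closed (\<phi> -` B)"
    using assms(2) closed_vimage[OF _ star_hom_continuous_on[OF assms(1)]]
    by (simp add: cstar_subalgebra_def)
  then show ?thesis
    using assms(2) by (simp add: cstar_subalgebra_def star_homD[OF assms(1)] star_hom_zero[OF assms(1)])
qed

lemma generates_cstar_image:
  assumes "star_hom \<phi>" "surj \<phi>" "generates_cstar G"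
  shows "generates_cstar (\<phi> ` G)"
  unfolding generates_cstar_def
proof (intro allI impI)
  fix B assume B: "cstar_subalgebra B \<and> \<phi> ` G \<subseteq> B"
  then have "\<phi> -` B = UNIV"
    using assms(3) cstar_subalgebra_vimage[OF assms(1), of B]
    unfolding generates_cstar_def image_subset_iff_subset_vimage by blast
  then show "B = UNIV" using assms(2) by (metis surj_image_vimage_eq)
qed

text \<open>By continuity the equalizer of two *-homomorphisms is closed, hence a C*-subalgebra.
  This supplies the uniqueness half of the universal property.\<close>

lemma star_hom_eqI:
  assumes "star_hom \<phi>" "star_hom \<psi>" "generates_cstar G" and "\<And>x. x \<in> G \<Longrightarrow> \<phi> x = \<psi> x"
  shows "\<phi> = \<psi>"
proof -
  have "closed {x. \<phi> x = \<psi> x}"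
    by (intro closed_Collect_eq star_hom_continuous_on assms)
  then have "cstar_subalgebra {x. \<phi> x = \<psi> x}"
    by (simp add: cstar_subalgebra_def star_homD[OF assms(1)] star_homD[OF assms(2)]
        star_hom_zero[OF assms(1)] star_hom_zero[OF assms(2)])
  then have "{x. \<phi> x = \<psi> x} = UNIV"
    using assms(3,4) unfolding generates_cstar_def by blast
  then show ?thesis by auto
qed


section \<open>Evaluation of the free *-algebra\<close>

fun eval_letter :: "('g \<Rightarrow> 'b::cstar_algebra) \<Rightarrow> 'g letter \<Rightarrow> 'b" where
  "eval_letter g (Pos x) = g x"
| "eval_letter g (Adj x) = (g x)\<^sup>\<star>"

fun eval_word :: "('g \<Rightarrow> 'b::cstar_algebra) \<Rightarrow> 'g star_word \<Rightarrow> 'b" where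
  "eval_word g (Word w) = prod_list (map (eval_letter g) w)"

definition free_eval :: "('g \<Rightarrow> 'b::cstar_algebra) \<Rightarrow> 'g free_star_algebra \<Rightarrow> 'b" where
  "free_eval g x = (\<Sum>w\<in>Poly_Mapping.keys x. Poly_Mapping.lookup x w *\<^sub>C eval_word g w)"

lemma eval_letter_star: "eval_letter g (letter_star l) = (eval_letter g l)\<^sup>\<star>"
  by (cases l) (simp_all add: star_star)

lemma eval_word_zero: "eval_word g 0 = 1"
  by (simp add: zero_star_word_def)

lemma eval_word_add: "eval_word g (u + w) = eval_word g u * eval_word g w"
  by (cases u; cases w) simp

lemma eval_word_star: "eval_word g (word_star w) = (eval_word g w)\<^sup>\<star>"
  by (cases w) (simp add: star_prod_list rev_map o_def eval_letter_star)

lemma scaleC_zero_left: "0 *\<^sub>C (x :: 'a::cstar_algebra) = 0"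
  using scaleR_scaleC[of 0 x] by simp

text \<open>Cancellation can shrink the support of a sum, so additivity of \<open>free_eval\<close>
  is proved over a common finite superset of the supports.\<close>

lemma free_eval_superset:
  assumes "finite A" "Poly_Mapping.keys x \<subseteq> A"
  shows "free_eval g x = (\<Sum>w\<in>A. Poly_Mapping.lookup x w *\<^sub>C eval_word g w)"
  unfolding free_eval_def using assms
  by (intro sum.mono_neutral_left) (auto simp: in_keys_iff scaleC_zero_left)

lemma free_eval_add: "free_eval g (x + y) = free_eval g x + free_eval g y"
proof -
  let ?A = "Poly_Mapping.keys x \<union> Poly_Mapping.keys y"
  show ?thesis
    using Poly_Mapping.keys_add[of x y]
    by (simp add: free_eval_superset[of ?A] lookup_add scaleC_add_left sum.distrib)
qed

lemma free_eval_single: "free_eval g (Poly_Mapping.single w c) = c *\<^sub>C eval_word g w"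
  using free_eval_superset[of "{w}" "Poly_Mapping.single w c" g] by simp

lemma free_eval_zero: "free_eval g 0 = 0"
  by (simp add: free_eval_def)

lemma free_eval_diff: "free_eval g (x - y) = free_eval g x - free_eval g y"
  using free_eval_add[of g "x - y" y] by simp

lemma free_eval_one: "free_eval g 1 = 1"
  using free_eval_single[of g 0 1] by (simp add: eval_word_zero)

lemma free_eval_gen: "free_eval g (free_gen x) = g x"
  by (simp add: free_gen_def free_eval_single)

lemma free_eval_single_mult:
  "free_eval g (Poly_Mapping.single w c * y) = free_eval g (Poly_Mapping.single w c) * free_eval g y"
  by (induction y rule: free_induct)
     (simp_all add: free_eval_zero distrib_left free_eval_add mult_single free_eval_single eval_word_add
       scaleC_mult_left scaleC_mult_right scaleC_scaleC mult.commute[of c])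

lemma free_eval_mult: "free_eval g (x * y) = free_eval g x * free_eval g y"
  by (induction x rule: free_induct)
     (simp_all add: free_eval_zero distrib_right free_eval_add free_eval_single_mult)

lemma free_eval_star: "free_eval g (free_star x) = (free_eval g x)\<^sup>\<star>"
  by (induction x rule: free_induct)
     (simp_all add: free_eval_zero free_star_add free_eval_add star_add free_star_single
       free_eval_single eval_word_star star_scaleC)

lemma free_eval_scale: "free_eval g (free_scale c x) = c *\<^sub>C free_eval g x"
  by (simp add: free_scale_conv free_eval_mult free_eval_single eval_word_zero scaleC_mult_left)

text \<open>Pulling back the norm along an evaluation makes it a candidate in the supremum that
  defines the universal seminorm.\<close>

lemma cstar_seminorm_free_eval: "cstar_seminorm (\<lambda>x. norm (free_eval g x))"
  unfolding cstar_seminorm_def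
  by (simp add: free_eval_add free_eval_scale free_eval_mult free_eval_star norm_triangle_ineq
      norm_mult_ineq norm_scaleC cstar_identity)


section \<open>The universal property of the full semigroup C*-algebra\<close>

lemma constructible_right_ideal [simp]: "right_ideal s \<in> constructible_ideals"
  by (auto simp: constructible_ideals_def)

lemma right_ideal_one: "right_ideal 1 = UNIV"
  by (auto simp: right_ideal_def)

lemma constructible_UNIV [simp]: "UNIV \<in> constructible_ideals"
  using constructible_right_ideal[of 1] by (simp add: right_ideal_one)

lemma constructible_empty [simp]: "{} \<in> constructible_ideals"
  by (simp add: constructible_ideals_def)

lemma constructible_translate [simp]:
  assumes "X \<in> constructible_ideals"
  shows "translate s X \<in> constructible_ideals"
proof -
  have "translate s (right_ideal t) = right_ideal (s * t)" for t
    by (auto simp: translate_def right_ideal_def mult.assoc)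
  then show ?thesis
    using assms by (auto simp: constructible_ideals_def translate_def)
qed

lemma constructible_Int [simp]:
  assumes "X \<in> constructible_ideals" "Y \<in> constructible_ideals"
  shows "(X :: 'a::right_lcm_monoid set) \<inter> Y \<in> constructible_ideals"
proof -
  have "right_ideal a \<inter> right_ideal b \<in> constructible_ideals" for a b :: 'a
    using right_lcm[of a b] unfolding right_ideal_def[symmetric]
    by (metis constructible_empty constructible_right_ideal)
  moreover have "Z = {} \<or> (\<exists>s. Z = right_ideal s)" if "Z \<in> constructible_ideals" for Z :: "'a set"
    using that unfolding constructible_ideals_def by blast
  ultimately show ?thesis using assms by (metis Int_empty_left Int_empty_right constructible_empty)
qed

lemma semigroup_relationsD:
  assumes "semigroup_relations v e"
  shows "isometry (v s)" "X \<in> constructible_ideals \<Longrightarrow> projection (e X)"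
    "v s * v t = v (s * t)"
    "X \<in> constructible_ideals \<Longrightarrow> v s * e X * (v s)\<^sup>\<star> = e (translate s X)"
    "e UNIV = 1" "e {} = 0"
    "X \<in> constructible_ideals \<Longrightarrow> Y \<in> constructible_ideals \<Longrightarrow> e X * e Y = e (X \<inter> Y)"
  using assms unfolding semigroup_relations_def by blast+

text \<open>The symbols \<open>Proj X\<close> with \<open>X\<close> not constructible are relators
  and must go to 0, whereas \<open>f\<close> is unconstrained on such sets.\<close>

fun generator_map :: "('a::right_lcm_monoid \<Rightarrow> 'b::cstar_algebra) \<Rightarrow> ('a set \<Rightarrow> 'b) \<Rightarrow> 'a generator \<Rightarrow> 'b" where
  "generator_map w f (Isom s) = w s"
| "generator_map w f (Proj X) = (if X \<in> constructible_ideals then f X else 0)"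

lemma free_eval_relator:
  assumes "semigroup_relations w f" "r \<in> semigroup_relators"
  shows "free_eval (generator_map w f) r = 0"
  using assms(2) semigroup_relationsD[OF assms(1)] unfolding semigroup_relators_def
  by (auto simp: free_eval_diff free_eval_mult free_eval_star free_eval_one free_eval_gen
      free_v_def free_e_def isometry_def projection_def)

lemma norm_free_eval_le:
  assumes "semigroup_relations w f"
  shows "norm (free_eval (generator_map w f) x) \<le> semigroup_seminorm x"
  by (rule semigroup_seminorm_upper)
     (simp add: relator_seminorms_def cstar_seminorm_free_eval free_eval_relator[OF assms])

lemma semigroup_cstar_cases:
  obtains X where "cauchy_seq X" "x = abs_semigroup_cstar X"
  by (metis Quotient_abs_rep[OF Quotient_semigroup_cstar]
      Quotient_rep_reflp[OF Quotient_semigroup_cstar] cauchy_rel_same)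

text \<open>Evaluation is contractive for \<open>semigroup_seminorm\<close>, so it extends by
  continuity from the free *-algebra to the completion. The algebraic identities pass to the
  limit.\<close>

lemma semigroup_cstar_universal:
  fixes w :: "'a::right_lcm_monoid \<Rightarrow> 'b::cstar_algebra"
  assumes rel: "semigroup_relations w f"
  obtains \<Phi> :: "'a semigroup_cstar \<Rightarrow> 'b" where "star_hom \<Phi>"
    "\<And>s. \<Phi> (univ_v s) = w s" "\<And>X. X \<in> constructible_ideals \<Longrightarrow> \<Phi> (univ_e X) = f X"
proof
  define E where "E = free_eval (generator_map w f)"
  have le: "norm (E x) \<le> semigroup_seminorm x" for x
    unfolding E_def by (rule norm_free_eval_le[OF rel])
  have diff: "E (x - y) = E x - E y" for x y by (simp add: E_def free_eval_diff)
  define \<Phi> where "\<Phi> x = lim (\<lambda>n. E (rep_semigroup_cstar x n))" for x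
  \<comment> \<open>The limit does not depend on the representative: two representatives differ by a
    null sequence, and \<open>le\<close> makes its image under \<open>E\<close> null as
    well.\<close>
  have lim: "(\<lambda>n. E (X n)) \<longlonglongrightarrow> \<Phi> (abs_semigroup_cstar X)" if X: "cauchy_seq X" for X
  proof -
    define Y where "Y = rep_semigroup_cstar (abs_semigroup_cstar X)"
    have "cauchy_rel Y X"
      unfolding Y_def using X by (intro Quotient_rep_abs[OF Quotient_semigroup_cstar]) simp
    then have "(\<lambda>n. semigroup_seminorm (Y n - X n)) \<longlonglongrightarrow> 0" by (simp add: cauchy_rel_def)
    then have YX: "(\<lambda>n. E (Y n) - E (X n)) \<longlonglongrightarrow> 0"
      by (rule Lim_null_comparison[rotated]) (simp add: le flip: diff)
    have "Cauchy (\<lambda>n. E (X n))"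
      using X unfolding Cauchy_def cauchy_seq_def dist_norm
      by (metis diff le le_less_trans)
    then obtain l where l: "(\<lambda>n. E (X n)) \<longlonglongrightarrow> l"
      using Cauchy_convergent convergent_def by blast
    from tendsto_add[OF YX l] have "\<Phi> (abs_semigroup_cstar X) = l"
      unfolding \<Phi>_def Y_def[symmetric] by (intro limI) simp
    then show ?thesis using l by simp
  qed
  have cls: "\<Phi> (semigroup_class x) = E x" for x
    using LIMSEQ_unique[OF lim[OF cauchy_seq_const[of x]] tendsto_const]
    by (simp add: semigroup_class_def)
  show "\<Phi> (univ_v s) = w s" for s
    by (simp add: univ_v_def cls E_def free_v_def free_eval_gen)
  show "\<Phi> (univ_e X) = f X" if "X \<in> constructible_ideals" for X
    using that by (simp add: univ_e_def cls E_def free_e_def free_eval_gen)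
  show "star_hom \<Phi>"
    unfolding star_hom_def
  proof (intro conjI allI)
    fix x y :: "'a semigroup_cstar" and c
    obtain X Y where X: "cauchy_seq X" "x = abs_semigroup_cstar X"
      and Y: "cauchy_seq Y" "y = abs_semigroup_cstar Y"
      using semigroup_cstar_cases by metis
    note lX = lim[OF X(1)] and lY = lim[OF Y(1)]
    show "\<Phi> (x + y) = \<Phi> x + \<Phi> y"
      using X Y LIMSEQ_unique[OF lim[OF cauchy_seq_add[OF X(1) Y(1)]]] tendsto_add[OF lX lY]
      by (simp add: plus_semigroup_cstar.abs_eq E_def free_eval_add)
    show "\<Phi> (x * y) = \<Phi> x * \<Phi> y"
      using X Y LIMSEQ_unique[OF lim[OF cauchy_seq_mult[OF X(1) Y(1)]]] tendsto_mult[OF lX lY]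
      by (simp add: times_semigroup_cstar.abs_eq E_def free_eval_mult)
    have "(\<lambda>n. (E (X n))\<^sup>\<star>) \<longlonglongrightarrow> (\<Phi> x)\<^sup>\<star>"
      using lX X(2) by (intro continuous_on_tendsto_compose[OF continuous_on_star]) auto
    then show "\<Phi> (x\<^sup>\<star>) = (\<Phi> x)\<^sup>\<star>"
      using X LIMSEQ_unique[OF lim[OF cauchy_seq_star[OF X(1)]]]
      by (simp add: star_semigroup_cstar.abs_eq E_def free_eval_star)
    \<comment> \<open>Writing the scalar as left multiplication by \<open>c *\<^sub>C 1\<close>
      reduces its continuity to that of the product.\<close>
    have "(\<lambda>n. (c *\<^sub>C 1) * E (X n)) \<longlonglongrightarrow> (c *\<^sub>C 1) * \<Phi> x"
      using lX X(2) by (intro tendsto_intros) auto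
    then show "\<Phi> (c *\<^sub>C x) = c *\<^sub>C \<Phi> x"
      using X LIMSEQ_unique[OF lim[OF cauchy_seq_scale[OF X(1), of c]]]
      by (simp add: scaleC_semigroup_cstar.abs_eq E_def free_eval_scale scaleC_mult_left)
  qed
qed

section \<open>The canonical generators of the full semigroup C*-algebra: their relations, and that
  they generate\<close>

lemma semigroup_class_add: "semigroup_class (x + y) = semigroup_class x + semigroup_class y"
  by (simp add: semigroup_class_def plus_semigroup_cstar.abs_eq)

lemma semigroup_class_mult: "semigroup_class (x * y) = semigroup_class x * semigroup_class y"
  by (simp add: semigroup_class_def times_semigroup_cstar.abs_eq)

lemma semigroup_class_scale: "semigroup_class (free_scale c x) = c *\<^sub>C semigroup_class x"
  by (simp add: semigroup_class_def scaleC_semigroup_cstar.abs_eq)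

lemma semigroup_class_one: "semigroup_class 1 = 1"
  by (simp add: semigroup_class_def one_semigroup_cstar_def)

lemma semigroup_class_zero: "semigroup_class 0 = 0"
  by (simp add: semigroup_class_def zero_semigroup_cstar_def)

lemma semigroup_relations_univ: "semigroup_relations univ_v univ_e"
proof -
  note eqI = semigroup_relator_class[unfolded semigroup_relators_def]
  have "isometry (univ_v s)" for s :: 'a
  proof -
    have "semigroup_class (free_star (free_v s) * free_v s - 1) = 0" by (rule eqI) blast
    then show ?thesis
      by (simp add: isometry_def univ_v_def semigroup_class_diff semigroup_class_mult univ_star
          semigroup_class_one)
  qed
  moreover have "projection (univ_e X)" if "X \<in> constructible_ideals" for X :: "'a set"
  proof -
    have "semigroup_class (free_e X * free_e X - free_e X) = 0" using that by (intro eqI) blast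
    then show ?thesis
      using univ_e_selfadjoint[OF that]
      by (simp add: projection_def univ_e_def semigroup_class_diff semigroup_class_mult)
  qed
  moreover have "univ_v s * univ_v t = univ_v (s * t)" for s t :: 'a
  proof -
    have "semigroup_class (free_v s * free_v t - free_v (s * t)) = 0" by (rule eqI) blast
    then show ?thesis by (simp add: univ_v_def semigroup_class_diff semigroup_class_mult)
  qed
  moreover have "univ_v s * univ_e X * (univ_v s)\<^sup>\<star> = univ_e (translate s X)"
    if "X \<in> constructible_ideals" for s :: 'a and X
  proof -
    have "semigroup_class (free_v s * free_e X * free_star (free_v s) - free_e (translate s X)) = 0"
      using that by (intro eqI) blast
    then show ?thesis
      by (simp add: univ_v_def univ_e_def semigroup_class_diff semigroup_class_mult univ_star)
  qed
  moreover have "univ_e (UNIV :: 'a set) = 1" "univ_e ({} :: 'a set) = 0"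
  proof -
    have "semigroup_class (free_e (UNIV :: 'a set) - 1) = 0" "semigroup_class (free_e ({} :: 'a set)) = 0"
      by (rule eqI, blast)+
    then show "univ_e (UNIV :: 'a set) = 1" "univ_e ({} :: 'a set) = 0"
      by (simp_all add: univ_e_def semigroup_class_diff semigroup_class_one)
  qed
  moreover have "univ_e X * univ_e Y = univ_e (X \<inter> Y)"
    if "X \<in> constructible_ideals" "Y \<in> constructible_ideals" for X Y :: "'a set"
  proof -
    have "semigroup_class (free_e X * free_e Y - free_e (X \<inter> Y)) = 0"
      using that by (intro eqI) blast
    then show ?thesis by (simp add: univ_e_def semigroup_class_diff semigroup_class_mult)
  qed
  ultimately show ?thesis unfolding semigroup_relations_def by (intro conjI allI ballI)
qed

text \<open>A C*-subalgebra with the generators contains the classes of letters, then of words, then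
  of all free elements. Those classes are dense.\<close>

lemma generates_cstar_univ:
  "generates_cstar (range univ_v \<union> univ_e ` (constructible_ideals :: 'a::right_lcm_monoid set set))"
  unfolding generates_cstar_def
proof (intro allI impI)
  fix B :: "'a semigroup_cstar set"
  assume asm: "cstar_subalgebra B \<and> range univ_v \<union> univ_e ` constructible_ideals \<subseteq> B"
  then have B: "closed B" "0 \<in> B" "\<And>x y. x \<in> B \<Longrightarrow> y \<in> B \<Longrightarrow> x + y \<in> B"
    "\<And>x y. x \<in> B \<Longrightarrow> y \<in> B \<Longrightarrow> x * y \<in> B" "\<And>c x. x \<in> B \<Longrightarrow> c *\<^sub>C x \<in> B"
    "\<And>x. x \<in> B \<Longrightarrow> x\<^sup>\<star> \<in> B"
    unfolding cstar_subalgebra_def by blast+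
  have vB: "univ_v s \<in> B" for s :: 'a using asm by (simp add: image_subset_iff)
  have eB: "univ_e X \<in> B" if "X \<in> constructible_ideals" for X :: "'a set"
    using asm that by (simp add: image_subset_iff)
  \<comment> \<open>\<open>cstar_subalgebra\<close> does not ask for the unit; it belongs to
    \<open>B\<close> as the generator \<open>univ_e UNIV\<close>. It is the class of the empty word
    below.\<close>
  have one: "1 \<in> B"
    using eB[OF constructible_UNIV] semigroup_relationsD(5)[OF semigroup_relations_univ[where 'a='a]]
    by simp
  have gen: "semigroup_class (free_gen g) \<in> B" for g :: "'a generator"
  proof (cases g)
    case (Isom s)
    then show ?thesis using vB[of s] by (simp add: univ_v_def free_v_def)
  next
    case (Proj X)
    have "semigroup_class (free_e X) = 0" if "X \<notin> constructible_ideals"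
      using that by (intro semigroup_relator_class) (auto simp: semigroup_relators_def)
    then show ?thesis using eB[of X] B(2) Proj
      by (cases "X \<in> constructible_ideals") (simp_all add: univ_e_def free_e_def)
  qed
  have letter: "semigroup_class (Poly_Mapping.single (Word [l]) 1) \<in> B" for l :: "'a generator letter"
  proof (cases l)
    case (Pos g)
    then show ?thesis using gen[of g] by (simp add: free_gen_def)
  next
    case (Adj g)
    then show ?thesis using B(6)[OF gen[of g]]
      by (simp add: free_gen_def free_star_single flip: univ_star)
  qed
  have word: "semigroup_class (Poly_Mapping.single (Word u) 1) \<in> B" for u :: "'a generator letter list"
  proof (induction u)
    case Nil
    then show ?case using one by (simp add: semigroup_class_one flip: zero_star_word_def)
  next
    case (Cons l u)
    have "Poly_Mapping.single (Word (l # u)) (1::complex) =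
        Poly_Mapping.single (Word [l]) 1 * Poly_Mapping.single (Word u) 1"
      by (simp add: mult_single)
    then show ?case using B(4)[OF letter Cons] by (simp add: semigroup_class_mult)
  qed
  have single: "semigroup_class (Poly_Mapping.single u c) \<in> B" for u :: "'a generator star_word" and c
  proof -
    obtain v where "u = Word v" by (cases u)
    moreover have "Poly_Mapping.single u c = free_scale c (Poly_Mapping.single u 1)"
      by (simp add: free_scale_conv mult_single)
    ultimately show ?thesis using B(5)[OF word] by (simp add: semigroup_class_scale)
  qed
  have free: "semigroup_class x \<in> B" for x :: "'a generator free_star_algebra"
    by (induction x rule: free_induct) (simp_all add: semigroup_class_zero semigroup_class_add B single)
  show "B = UNIV"
  proof (rule UNIV_eq_I[symmetric])
    fix x :: "'a semigroup_cstar"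
    obtain X where X: "cauchy_seq X" "x = abs_semigroup_cstar X" by (rule semigroup_cstar_cases)
    show "x \<in> B"
      using closed_sequentially[OF B(1) _ cauchy_seq_class_tendsto[OF X(1)]] free X(2) by blast
  qed
qed


section \<open>The boundary quotient\<close>

text \<open>On expanding the product all mixed terms vanish. In the induction the only one is
  \<open>p a\<close> times the remaining sum.\<close>

lemma prod_list_one_minus_orthogonal:
  fixes p :: "'i \<Rightarrow> 'b::{ring, monoid_mult}"
  assumes "distinct xs" and "\<And>s t. s \<in> set xs \<Longrightarrow> t \<in> set xs \<Longrightarrow> s \<noteq> t \<Longrightarrow> p s * p t = 0"
  shows "prod_list (map (\<lambda>s. 1 - p s) xs) = 1 - (\<Sum>s\<in>set xs. p s)"
  using assms
proof (induction xs)
  case (Cons a xs)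
  have "p a * (\<Sum>s\<in>set xs. p s) = (\<Sum>s\<in>set xs. p a * p s)" by (rule sum_distrib_left)
  also have "\<dots> = 0" using Cons.prems by (intro sum.neutral) auto
  finally have "p a * (\<Sum>s\<in>set xs. p s) = 0" .
  moreover have "prod_list (map (\<lambda>s. 1 - p s) xs) = 1 - (\<Sum>s\<in>set xs. p s)"
    using Cons by auto
  ultimately show ?case using Cons.prems(1) by (simp add: left_diff_distrib right_diff_distrib)
qed simp

text \<open>The factor \<open>1 - p s\<close> annihilates \<open>q\<close>, and \<open>q\<close> can
  be moved next to it because it commutes with every factor.\<close>

lemma prod_list_one_minus_absorb:
  fixes p :: "'i \<Rightarrow> 'b::{ring, monoid_mult}"
  assumes "s \<in> set xs" "p s * q = q" and comm: "\<And>t. p t * q = q * p t"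
  shows "prod_list (map (\<lambda>s. 1 - p s) xs) * q = 0"
  using assms(1)
proof (induction xs)
  case (Cons a xs)
  let ?P = "prod_list (map (\<lambda>s. 1 - p s) xs)"
  \<comment> \<open>Needed when the annihilating factor is the head: \<open>q\<close> then has to
    pass the whole tail.\<close>
  have P: "?P * q = q * ?P"
  proof (induction xs)
    case (Cons b ys)
    have "(1 - p b) * q = q * (1 - p b)" by (simp add: algebra_simps comm)
    then show ?case using Cons by simp (metis mult.assoc)
  qed simp
  show ?case
  proof (cases "s \<in> set xs")
    case True
    then show ?thesis using Cons.IH by (simp add: mult.assoc)
  next
    case False
    then have "(1 - p a) * q = 0" using Cons.prems assms(2) by (simp add: algebra_simps)
    then show ?thesis by (simp add: mult.assoc P) (simp flip: mult.assoc)
  qed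
qed simp

lemma right_ideal_mono:
  fixes s t :: "'a::monoid_mult"
  assumes "t \<in> right_ideal s"
  shows "right_ideal t \<subseteq> right_ideal s"
  using assms by (auto simp: right_ideal_def mult.assoc)

context
  fixes v :: "'a::right_lcm_monoid \<Rightarrow> 'b::cstar_algebra" and e :: "'a set \<Rightarrow> 'b"
  assumes rel: "semigroup_relations v e"
begin

lemma e_mult: "e (right_ideal s) * e (right_ideal t) = e (right_ideal s \<inter> right_ideal t)"
  by (simp add: semigroup_relationsD(7)[OF rel])

lemma accurate_prod:
  assumes "distinct xs" "accurate_foundation_set (set xs)"
  shows "prod_list (map (\<lambda>s. 1 - e (right_ideal s)) xs) = 1 - (\<Sum>s\<in>set xs. e (right_ideal s))"
proof (rule prod_list_one_minus_orthogonal[OF assms(1)])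
  fix s t assume "s \<in> set xs" "t \<in> set xs" "s \<noteq> t"
  then have "right_ideal s \<inter> right_ideal t = {}"
    using assms(2) by (simp add: accurate_foundation_set_def)
  then show "e (right_ideal s) * e (right_ideal t) = 0"
    by (simp add: e_mult semigroup_relationsD(6)[OF rel])
qed

text \<open>If \<open>t\<close> lies in \<open>right_ideal s\<close>, then
  \<open>e (right_ideal s)\<close> absorbs \<open>e (right_ideal t)\<close>, so the factor belonging
  to \<open>s\<close> kills that summand.\<close>

lemma refinement_prod:
  assumes "\<And>t. t \<in> F \<Longrightarrow> \<exists>s\<in>set xs. t \<in> right_ideal s"
  shows "prod_list (map (\<lambda>s. 1 - e (right_ideal s)) xs) * (\<Sum>t\<in>F. e (right_ideal t)) = 0"
  unfolding sum_distrib_left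
proof (rule sum.neutral, rule ballI)
  fix t assume "t \<in> F"
  then obtain s where s: "s \<in> set xs" "t \<in> right_ideal s" using assms by blast
  then have "right_ideal s \<inter> right_ideal t = right_ideal t" using right_ideal_mono by blast
  then show "prod_list (map (\<lambda>s. 1 - e (right_ideal s)) xs) * e (right_ideal t) = 0"
    using s(1) by (intro prod_list_one_minus_absorb[of s]) (simp_all add: e_mult Int_commute)
qed

text \<open>Unitality is assumed separately since \<open>star_hom\<close> does not include it; it
  preserves the isometry relation and \<open>e UNIV = 1\<close>.\<close>

lemma semigroup_relations_star_hom:
  assumes \<phi>: "star_hom \<phi>" "\<phi> 1 = 1"
  shows "semigroup_relations (\<lambda>s. \<phi> (v s)) (\<lambda>X. \<phi> (e X))"
  using semigroup_relationsD[OF rel]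
  unfolding semigroup_relations_def isometry_def projection_def star_homD[OF \<phi>(1), symmetric]
  by (intro conjI allI ballI) (simp_all only: star_hom_zero[OF \<phi>(1)] \<phi>(2))

end

section \<open>Comparison of the ideals generated by the two families of relators\<close>

lemma accurate_relators_subset: "accurate_relators \<subseteq> boundary_ideal"
proof
  fix r :: "'a semigroup_cstar"
  assume "r \<in> accurate_relators"
  then obtain F :: "'a set" where F: "accurate_foundation_set F"
    and r: "r = (\<Sum>s\<in>F. univ_e (right_ideal s)) - 1"
    by (auto simp: accurate_relators_def)
  then obtain xs where xs: "distinct xs" "set xs = F" and "foundation_set F"
    using finite_distinct_list[of F] by (auto simp: accurate_foundation_set_def foundation_set_def)
  then have "prod_list (map (\<lambda>s. 1 - univ_e (right_ideal s)) xs) \<in> boundary_relators"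
    unfolding boundary_relators_def by blast
  \<comment> \<open>By orthogonality the boundary relator along the enumeration \<open>xs\<close> is
    the negative of the accurate relator of \<open>F\<close>.\<close>
  then have "1 - (\<Sum>s\<in>F. univ_e (right_ideal s)) \<in> boundary_ideal"
    using accurate_prod[OF semigroup_relations_univ xs(1)] F xs(2)
    by (metis boundary_ideal_def closed_ideal_generated_base subsetD)
  from bi_minus[OF this] show "r \<in> boundary_ideal" by (simp add: r)
qed

lemma boundary_ideal_eq:
  assumes "accurate_refinement_property TYPE('a::right_lcm_monoid)"
  shows "(boundary_ideal :: 'a semigroup_cstar set) = closed_ideal_generated accurate_relators"
proof
  show "closed_ideal_generated accurate_relators \<subseteq> (boundary_ideal :: 'a semigroup_cstar set)"
    by (rule closed_ideal_generated_least[OF closed_ideal_boundary_ideal accurate_relators_subset])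
  let ?J = "closed_ideal_generated accurate_relators :: 'a semigroup_cstar set"
  have J: "closed_ideal ?J" by (rule closed_ideal_closed_ideal_generated)
  show "boundary_ideal \<subseteq> ?J"
    unfolding boundary_ideal_def
  proof (rule closed_ideal_generated_least[OF J], rule subsetI)
    fix r :: "'a semigroup_cstar"
    assume "r \<in> boundary_relators"
    then obtain xs where xs: "foundation_set (set xs)"
      and r: "r = prod_list (map (\<lambda>s. 1 - univ_e (right_ideal s)) xs)"
      by (auto simp: boundary_relators_def)
    obtain F where F: "accurate_foundation_set F" "\<And>t. t \<in> F \<Longrightarrow> \<exists>s\<in>set xs. t \<in> right_ideal s"
      using assms xs unfolding accurate_refinement_property_def by blast
    let ?a = "(\<Sum>s\<in>F. univ_e (right_ideal s)) - 1"
    have "?a \<in> ?J"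
      using F(1) closed_ideal_generated_base[of accurate_relators] by (auto simp: accurate_relators_def)
    then have "- (r * ?a) \<in> ?J" by (intro ideal_minus[OF J] idealD(5)[OF J])
    \<comment> \<open>As \<open>r\<close> annihilates the sum over the refinement, only the summand
      \<open>- 1\<close> of \<open>?a\<close> survives, so \<open>r\<close> is a multiple of an
      accurate relator.\<close>
    moreover have "- (r * ?a) = r"
      using refinement_prod[OF semigroup_relations_univ F(2)] by (simp add: r right_diff_distrib)
    ultimately show "r \<in> ?J" by simp
  qed
qed

section \<open>The quotient map onto the boundary quotient and the universal property\<close>

lemma star_hom_boundary_map: "star_hom boundary_map"
  by (simp add: star_hom_def boundary_map_def plus_boundary_quotient.abs_eq
      scaleC_boundary_quotient.abs_eq times_boundary_quotient.abs_eq star_boundary_quotient.abs_eq)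

lemma surj_boundary_map: "surj boundary_map"
  by (metis surjI boundary_map_def Quotient_abs_rep[OF Quotient_boundary_quotient])

lemma boundary_map_one: "boundary_map 1 = 1"
  by (simp add: boundary_map_def one_boundary_quotient_def)

lemma semigroup_relations_boundary: "semigroup_relations boundary_v boundary_e"
  using semigroup_relations_star_hom[OF semigroup_relations_univ star_hom_boundary_map boundary_map_one]
  by (simp add: boundary_v_def[abs_def] boundary_e_def[abs_def])

lemma accurate_sum_relation_boundary: "accurate_sum_relation boundary_e"
  unfolding accurate_sum_relation_def
proof (intro allI impI)
  fix F :: "'a set"
  assume "accurate_foundation_set F"
  then have "(\<Sum>s\<in>F. univ_e (right_ideal s)) - 1 \<in> boundary_ideal"
    using accurate_relators_subset unfolding accurate_relators_def by blast
  then show "(\<Sum>s\<in>F. boundary_e (right_ideal s)) = 1"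
    by (simp add: boundary_e_def flip: boundary_map_eq_iff boundary_map_sum boundary_map_one)
qed

text \<open>The type \<open>boundary_quotient\<close> is built from \<open>boundary_ideal\<close>,
  so any relators generating that ideal present the same quotient. This is applied to
  \<open>accurate_relators\<close>.\<close>

lemma is_quotient_by_boundary_ideal:
  fixes R :: "'a::right_lcm_monoid semigroup_cstar set"
  assumes "boundary_ideal = closed_ideal_generated R"
  shows "is_quotient_by boundary_map R"
proof -
  have "boundary_map x = 0 \<longleftrightarrow> x \<in> boundary_ideal" for x :: "'a semigroup_cstar"
    using boundary_map_eq_iff[of x 0] by (simp add: boundary_map_zero)
  then have "{x :: 'a semigroup_cstar. boundary_map x = 0} = boundary_ideal" by blast
  then show ?thesis
    unfolding is_quotient_by_def assms[symmetric]
    by (intro conjI allI star_hom_boundary_map surj_boundary_map norm_boundary_map)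
qed

lemma generates_cstar_boundary:
  "generates_cstar (range boundary_v \<union> boundary_e ` constructible_ideals)"
  using generates_cstar_image[OF star_hom_boundary_map surj_boundary_map generates_cstar_univ]
  by (simp add: image_Un image_image boundary_v_def[abs_def] boundary_e_def[abs_def])

lemma boundary_map_factor:
  fixes \<Phi> :: "'a::right_lcm_monoid semigroup_cstar \<Rightarrow> 'b::cstar_algebra"
  assumes "star_hom \<Phi>" and "\<And>x. x \<in> boundary_ideal \<Longrightarrow> \<Phi> x = 0"
  obtains \<phi> where "star_hom \<phi>" "\<And>x. \<phi> (boundary_map x) = \<Phi> x"
proof
  \<comment> \<open>An arbitrary preimage is chosen; two preimages differ by an element of
    \<open>boundary_ideal\<close>, on which \<open>\<Phi>\<close> vanishes.\<close>
  define \<phi> where "\<phi> z = \<Phi> (inv boundary_map z)" for z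
  show eq: "\<phi> (boundary_map x) = \<Phi> x" for x
  proof -
    have "boundary_map (inv boundary_map (boundary_map x)) = boundary_map x"
      by (rule surj_f_inv_f[OF surj_boundary_map])
    then have "\<Phi> (inv boundary_map (boundary_map x) - x) = 0"
      unfolding boundary_map_eq_iff by (rule assms(2))
    then show ?thesis by (simp add: \<phi>_def star_hom_diff[OF assms(1)])
  qed
  show "star_hom \<phi>"
    unfolding star_hom_def
  proof (intro conjI allI)
    fix x y :: "'a boundary_quotient" and c
    obtain x' y' where "x = boundary_map x'" "y = boundary_map y'"
      using surj_boundary_map by (metis surjD)
    then show "\<phi> (x + y) = \<phi> x + \<phi> y" "\<phi> (c *\<^sub>C x) = c *\<^sub>C \<phi> x"
      "\<phi> (x * y) = \<phi> x * \<phi> y" "\<phi> (x\<^sup>\<star>) = (\<phi> x)\<^sup>\<star>"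
      by (simp_all add: eq star_homD[OF assms(1)] flip: star_homD[OF star_hom_boundary_map])
  qed
qed

text \<open>The representation first extends to \<open>semigroup_cstar\<close>. The kernel of that
  extension is a closed ideal containing the accurate relators, and (AR) identifies the ideal they
  generate with \<open>boundary_ideal\<close>, so the extension factors. Uniqueness holds because
  the generators determine a *-homomorphism.\<close>

lemma boundary_universal:
  fixes w :: "'a::right_lcm_monoid \<Rightarrow> 'b::cstar_algebra"
  assumes ar: "accurate_refinement_property TYPE('a)"
    and rel: "semigroup_relations w f" and acc: "accurate_sum_relation f"
  shows "\<exists>!\<phi> :: 'a boundary_quotient \<Rightarrow> 'b. star_hom \<phi> \<and> (\<forall>s. \<phi> (boundary_v s) = w s) \<and>
    (\<forall>X\<in>constructible_ideals. \<phi> (boundary_e X) = f X)"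
proof -
  obtain \<Phi> :: "'a semigroup_cstar \<Rightarrow> 'b" where \<Phi>: "star_hom \<Phi>" "\<And>s. \<Phi> (univ_v s) = w s"
    "\<And>X. X \<in> constructible_ideals \<Longrightarrow> \<Phi> (univ_e X) = f X"
    using semigroup_cstar_universal[OF rel] by blast
  \<comment> \<open>Unitality comes from \<open>univ_e UNIV = 1\<close> and
    \<open>f UNIV = 1\<close>; it is what sends the term \<open>- 1\<close> of an accurate relator
    to \<open>- 1\<close>.\<close>
  have "\<Phi> 1 = 1"
    using \<Phi>(3)[of UNIV] semigroup_relationsD(5)[OF rel]
      semigroup_relationsD(5)[OF semigroup_relations_univ[where 'a='a]] by simp
  then have "accurate_relators \<subseteq> {x. \<Phi> x = 0}"
    using acc by (auto simp: accurate_relators_def accurate_sum_relation_def \<Phi>(3)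
        star_hom_diff[OF \<Phi>(1)] star_hom_sum[OF \<Phi>(1)])
  then have "\<Phi> x = 0" if "x \<in> boundary_ideal" for x
    using that closed_ideal_generated_least[OF closed_ideal_kernel[OF \<Phi>(1)]] boundary_ideal_eq[OF ar]
    by blast
  then obtain \<phi> where \<phi>: "star_hom \<phi>" "\<And>x. \<phi> (boundary_map x) = \<Phi> x"
    using boundary_map_factor[OF \<Phi>(1)] by blast
  show ?thesis
  proof (rule ex1I[of _ \<phi>])
    show "star_hom \<phi> \<and> (\<forall>s. \<phi> (boundary_v s) = w s) \<and>
        (\<forall>X\<in>constructible_ideals. \<phi> (boundary_e X) = f X)"
      by (simp add: \<phi> \<Phi> boundary_v_def boundary_e_def)
    then show "\<psi> = \<phi>" if "star_hom \<psi> \<and> (\<forall>s. \<psi> (boundary_v s) = w s) \<and>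
        (\<forall>X\<in>constructible_ideals. \<psi> (boundary_e X) = f X)" for \<psi>
      using that by (intro star_hom_eqI[OF _ _ generates_cstar_boundary]) auto
  qed
qed

theorem proposition2p4:
  shows "(\<forall>F :: 'a::right_lcm_monoid set.
            accurate_foundation_set F \<longrightarrow> (\<Sum>s\<in>F. boundary_e (right_ideal s)) = 1) \<and>
    (accurate_refinement_property TYPE('a) \<longrightarrow>
       is_quotient_by (boundary_map :: 'a semigroup_cstar \<Rightarrow> 'a boundary_quotient) accurate_relators \<and>
       semigroup_relations (boundary_v :: 'a \<Rightarrow> 'a boundary_quotient) boundary_e \<and>
       accurate_sum_relation (boundary_e :: 'a set \<Rightarrow> 'a boundary_quotient) \<and>
       generates_cstar (range (boundary_v :: 'a \<Rightarrow> 'a boundary_quotient) \<union>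
         boundary_e ` constructible_ideals) \<and>
       (\<forall>(w :: 'a \<Rightarrow> 'b::cstar_algebra) (f :: 'a set \<Rightarrow> 'b).
          semigroup_relations w f \<and> accurate_sum_relation f \<longrightarrow>
          (\<exists>!\<phi> :: 'a boundary_quotient \<Rightarrow> 'b. star_hom \<phi> \<and>
             (\<forall>s. \<phi> (boundary_v s) = w s) \<and>
             (\<forall>X\<in>constructible_ideals. \<phi> (boundary_e X) = f X))))"
proof (intro conjI allI impI)
  show "(\<Sum>s\<in>F. boundary_e (right_ideal s)) = 1" if "accurate_foundation_set F" for F :: "'a set"
    using accurate_sum_relation_boundary[where 'a='a] that unfolding accurate_sum_relation_def by blast
  assume ar: "accurate_refinement_property TYPE('a)"
  show "is_quotient_by (boundary_map :: 'a semigroup_cstar \<Rightarrow> 'a boundary_quotient) accurate_relators"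
    by (rule is_quotient_by_boundary_ideal[OF boundary_ideal_eq[OF ar]])
  show "semigroup_relations (boundary_v :: 'a \<Rightarrow> 'a boundary_quotient) boundary_e"
    by (rule semigroup_relations_boundary)
  show "accurate_sum_relation (boundary_e :: 'a set \<Rightarrow> 'a boundary_quotient)"
    by (rule accurate_sum_relation_boundary)
  show "generates_cstar (range (boundary_v :: 'a \<Rightarrow> 'a boundary_quotient) \<union>
      boundary_e ` constructible_ideals)"
    by (rule generates_cstar_boundary)
  fix w :: "'a \<Rightarrow> 'b" and f
  assume wf: "semigroup_relations w f \<and> accurate_sum_relation f"
  show "\<exists>!\<phi> :: 'a boundary_quotient \<Rightarrow> 'b. star_hom \<phi> \<and>
      (\<forall>s. \<phi> (boundary_v s) = w s) \<and> (\<forall>X\<in>constructible_ideals. \<phi> (boundary_e X) = f X)"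
    by (rule boundary_universal[OF ar conjunct1[OF wf] conjunct2[OF wf]])
qed

end
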